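(* Let $d\ge 1$ and let $a:\mathbb{Z}^d\to\mathbb{R}$ be the transition intensities of a continuous-time random walk on $\mathbb{Z}^d$ as described in the context, satisfying for some $\alpha\in(0,2)$ the asymptotic condition \[ a(z)\sim\frac{H\!\left(\frac{z}{|z|}\right)}{|z|^{d+\alpha}}\quad\text{as } |z|\to\infty, \] where $H$ is a continuous, positive, symmetric function on the unit sphere $\mathbb{S}^{d-1}=\{z\in\mathbb{R}^d: |z|=1\}$. Let $G_\lambda=G_\lambda(0,0)=\int_0^\infty e^{-\lambda t}p(t,0,0)\,dt$ and $G_0=G_0(0,0)$. Then, as $\lambda\downarrow 0$, the following asymptotic equalities hold: \begin{itemize} \item[(i)] $G_{\lambda}\sim\gamma_{d,\alpha}\lambda^{\frac{1-\alpha}{\alpha}}$ for $d=1$, $\alpha\in(1,2)$; \item[(ii)] $G_{\lambda}\sim -\gamma_{d,\alpha}\ln \lambda$ for $d=1$, $\alpha=1$; \item[(iii)] $G_{\lambda}-G_{0}\sim-\gamma_{d,\alpha}\lambda^{\frac{d-\alpha}{\alpha}}$ for $d=1$, $\alpha\in(\frac{1}{2},1)$, or $d=2$, $\alpha\in(1,2)$, or $d=3$, $\alpha\in(\frac{3}{2},2)$; \item[(iv)] $G_{\lambda}-G_{0}\sim\gamma_{d,\alpha}\lambda\ln\lambda$ for $d=1$, $\alpha=\frac{1}{2}$, or $d=2$, $\alpha=1$, or $d=3$, $\alpha=\frac{3}{2}$; \item[(v)] $G_{\lambda}-G_{0}\sim-\gamma_{d,\alpha}\lambda$ for $d=1$,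 $\alpha\in(0,\frac{1}{2})$, or $d=2$, $\alpha\in(0,1)$, or $d=3$, $\alpha\in(0,\frac{3}{2})$, or $d\ge4$, $\alpha\in(0,2)$, \end{itemize} where in each case $\gamma_{d,\alpha}$ is some positive constant (depending on $d$ and $\alpha$).
   Context: The random walk on $\mathbb{Z}^d$ is given by a matrix $A=(a(x,y))_{x,y\in\mathbb{Z}^d}$ of transition intensities with $a(x,y)\ge 0$ for $x\ne y$, $a(x,x)<0$, $a(x,y)=a(y,x)=a(0,y-x)=:a(y-x)$ (symmetric and space-homogeneous), $\sum_z a(z)=0$, and $A$ irreducible: every $z\in\mathbb{Z}^d$ can be written as $z=\sum_{i=1}^k z_i$ with $a(z_i)\ne0$ for all $i$. Here $|z|$ is the Euclidean norm. $p(t,x,y)$ denotes the transition probability of this continuous-time Markov random walk (from $x$ to $y$ in time $t$), and $G_\lambda(x,y)=\int_0^\infty e^{-\lambda t}p(t,x,y)\,dt$, $\lambda\ge0$, is its Green function (possibly $+\infty$ at $\lambda=0$). Under the hypotheses, $G_0=\infty$ in cases (i),(ii) and $G_0<\infty$ in cases (iii)–(v). For functions, $f\sim g$ means $f/g\to1$. *)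

theory Defs
  imports "HOL-Analysis.Analysis" "HOL-Library.Landau_Symbols"
begin

definition vec_of :: "int ^ 'n \<Rightarrow> real ^ 'n" where
  "vec_of z = (\<chi> i. real_of_int (z $ i))"

text \<open>Standing assumptions on the transition intensities a(z) = a(0,z).\<close>
definition rw_intensities :: "(int ^ 'n \<Rightarrow> real) \<Rightarrow> bool" where
  "rw_intensities a \<longleftrightarrow>
     (\<forall>z. z \<noteq> 0 \<longrightarrow> a z \<ge> 0) \<and> a 0 < 0 \<and> (\<forall>z. a (- z) = a z) \<and>
     a summable_on UNIV \<and> infsum a UNIV = 0 \<and>
     (\<forall>z. \<exists>zs. (\<forall>w\<in>set zs. a w \<noteq> 0) \<and> sum_list zs = z)"

text \<open>Entries of the powers of the matrix A: A^n(x,y) = apow a n (y - x).\<close>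
fun apow :: "(int ^ 'n \<Rightarrow> real) \<Rightarrow> nat \<Rightarrow> int ^ 'n \<Rightarrow> real" where
  "apow a 0 w = (if w = 0 then 1 else 0)"
| "apow a (Suc n) w = (\<Sum>\<^sub>\<infinity>z. a z * apow a n (w - z))"

text \<open>Transition probability p(t,x,y) = (exp (t A))(x,y) (A is a bounded generator).\<close>
definition trans_prob :: "(int ^ 'n \<Rightarrow> real) \<Rightarrow> real \<Rightarrow> int ^ 'n \<Rightarrow> int ^ 'n \<Rightarrow> real" where
  "trans_prob a t x y = (\<Sum>n. t ^ n / fact n * apow a n (y - x))"

definition green0 :: "(int ^ 'n \<Rightarrow> real) \<Rightarrow> real \<Rightarrow> real" where
  "green0 a l = (LINT t:{0..}|lborel. exp (- l * t) * trans_prob a t 0 0)"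

end

theory Submission
  imports Defs "HOL-Real_Asymp.Real_Asymp"
begin

text \<open>
  Write \<open>\<phi>(\<theta>) = \<Sum>z. a(z) (1 - cos (z \<bullet> \<theta>))\<close> for the symbol of the walk; then
  \<open>p(t,0,0)\<close> is the normalised integral of \<open>exp (- t \<phi>(\<theta>))\<close> over the torus. Reading the lattice sum
  \<open>\<epsilon> powr (- \<alpha>) * \<phi>(\<epsilon> u)\<close> as the integral of a step function with cells of side \<open>\<epsilon>\<close>, dominated
  convergence yields the limit
  \<open>\<psi>(u) = \<integral> H(x / |x|) / |x| powr (d + \<alpha>) * (1 - cos (x \<bullet> u)) dx > 0\<close>, locally uniformly in \<open>u\<close>.
  Compactness turns this into \<open>\<phi>(\<theta>) \<ge> c |\<theta>| powr \<alpha>\<close> on the torus, and a second application of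
  dominated convergence gives \<open>t powr (d / \<alpha>) * p(t,0,0) \<longlongrightarrow> C > 0\<close>. The five cases are then Abelian
  theorems for the Laplace transform of a function with tail \<open>C t powr (- s)\<close>, \<open>s = d / \<alpha>\<close>:
  \<open>s < 1\<close>, \<open>s = 1\<close>, \<open>1 < s < 2\<close>, \<open>s = 2\<close> and \<open>s > 2\<close>.
\<close>

subsection \<open>Fourier representation of the transition probability\<close>

text \<open>The lattice sum is a Riemann sum whose integrand is singular at 0 and has unbounded
  support, so its convergence needs one majorant valid for every mesh: \<open>levy_bound\<close>,
  integrable at 0 because \<alpha> < 2 and at infinity because \<alpha> > 0. The cell around the
  origin, where the singularity would defeat such a bound, carries the factor 1 - cos 0. Local
  uniformity is expressed by sequences in which \<epsilon> and u vary together; this is what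
  compactness needs, since a sequence violating the lower bound may approach 0 along varying
  directions. Away from 0, irreducibility excludes further zeros of the symbol. The lower bound in
  turn gives the majorant exp (- c |u| powr \<alpha>) after the substitution \<theta> = t powr (- 1
  / \<alpha>) u, under which the torus grows to the whole space. The thresholds 1 and 2 for s come
  from the kernels exp (- x) for G_\<lambda> and 1 - exp (- x) for G_0 - G_\<lambda>: against t powr
  (- s) the former is integrable iff s < 1, the latter iff 1 < s < 2. The values s = 1 and s = 2
  miss by a logarithm, and for s > 2 the integral of t p(t,0,0) is finite.\<close>

definition torus :: "(real ^ 'n) set" where
  "torus = cbox (- (pi *\<^sub>R One)) (pi *\<^sub>R One)"

text \<open>The sum is a Bochner integral against counting measure, so that dominated convergence
  and Fubini apply to it. The only negative weight, \<open>a 0\<close>, is multiplied by 0.\<close>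

definition symb :: "(int ^ 'n \<Rightarrow> real) \<Rightarrow> real ^ 'n \<Rightarrow> real" where
  "symb a \<theta> = (\<integral>z. a z * (1 - cos (vec_of z \<bullet> \<theta>)) \<partial>count_space UNIV)"

lemma vec_of_simps [simp]:
  "vec_of 0 = 0" "vec_of (- z) = - vec_of z" "vec_of (w - z) = vec_of w - vec_of z"
  "vec_of z $ i = real_of_int (z $ i)"
  by (simp_all add: vec_of_def vec_eq_iff)

lemma vec_of_eq_0_iff [simp]: "vec_of z = 0 \<longleftrightarrow> z = 0"
  by (simp add: vec_eq_iff)

lemma norm_vec_of_ge_1:
  assumes "z \<noteq> 0" shows "1 \<le> norm (vec_of z)"
proof -
  obtain i where "z $ i \<noteq> 0" using assms by (auto simp: vec_eq_iff)
  then have "1 \<le> \<bar>vec_of z $ i\<bar>" by simp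
  also have "\<dots> \<le> norm (vec_of z)" by (rule component_le_norm_cart)
  finally show ?thesis .
qed

section \<open>Orthogonality of the characters on the torus\<close>

lemma integral_cis_full_period:
  fixes k :: real
  assumes "k \<in> \<int>"
  shows "(\<integral>x. indicator {-pi..pi} x *\<^sub>R cis (k * x) \<partial>lborel) = (if k = 0 then of_real (2 * pi) else 0)"
proof (cases "k = 0")
  case True
  then show ?thesis by (simp add: scaleR_conv_of_real)
next
  case False
  have "((\<lambda>z. exp (\<i> * (of_real k * z)) / (\<i> * of_real k)) has_field_derivative exp (\<i> * (of_real k * of_real x))) (at (of_real x))" for x
    using False by (auto intro!: derivative_eq_intros simp: mult_ac)
  from has_vector_derivative_real_field[OF this]
  have "((\<lambda>x. cis (k * x) / (\<i> * of_real k)) has_vector_derivative cis (k * x)) (at x within {-pi..pi})" for x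
    by (simp add: cis_conv_exp)
  then have "(\<integral>x. indicator {-pi..pi} x *\<^sub>R cis (k * x) \<partial>lborel)
     = cis (k * pi) / (\<i> * of_real k) - cis (k * (-pi)) / (\<i> * of_real k)"
    by (intro integral_FTC_Icc) (auto intro!: continuous_intros)
  \<comment> \<open>Integrality of k enters here: sin (k pi) = 0 and the cosine is even, so the
    boundary terms cancel.\<close>
  also have "cis (k * pi) = cis (k * (-pi))"
    using assms by (auto elim!: Ints_cases simp: complex_eq_iff sin_npi_int mult.commute[of _ pi])
  finally show ?thesis using False by simp
qed

text \<open>Character and indicator of the cube both factorise over the coordinates, so the integral
  is a product of one-dimensional ones, and a single nonzero integer coordinate of v makes it
  vanish.\<close>

lemma integral_torus_cis:
  fixes v :: "real ^ 'n"
  assumes v: "\<And>b. b \<in> Basis \<Longrightarrow> v \<bullet> b \<in> \<int>"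
  shows "(\<integral>x. indicator torus x *\<^sub>R cis (v \<bullet> x) \<partial>lborel) = (if v = 0 then of_real ((2 * pi) ^ CARD('n)) else 0)"
proof -
  interpret product_sigma_finite "\<lambda>_. lborel :: real measure" ..
  define F where "F b x = indicator {-pi..pi} x *\<^sub>R cis (v \<bullet> b * x)" for b x
  have intF: "integrable lborel (F b)" for b
    unfolding F_def by (intro borel_integrable_compact) (auto intro!: continuous_intros)
  have prod: "indicator torus x *\<^sub>R cis (v \<bullet> x) = (\<Prod>b\<in>Basis. F b (x \<bullet> b))" for x :: "real ^ 'n"
  proof -
    have "(\<Prod>b\<in>Basis. F b (x \<bullet> b)) = (\<Prod>b\<in>Basis. of_real (indicator {-pi..pi} (x \<bullet> b)) * cis (v \<bullet> b * (x \<bullet> b)))"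
      by (simp add: F_def scaleR_conv_of_real)
    also have "\<dots> = of_real (\<Prod>b\<in>Basis. indicator {-pi..pi} (x \<bullet> b)) * (\<Prod>b\<in>Basis. cis (v \<bullet> b * (x \<bullet> b)))"
      by (simp add: prod.distrib)
    also have "(\<Prod>b\<in>Basis. indicator {-pi..pi} (x \<bullet> b)) = (indicator torus x :: real)"
      by (auto simp: torus_def indicator_def mem_box prod_zero_iff)
    also have "(\<Prod>b\<in>Basis. cis (v \<bullet> b * (x \<bullet> b))) = cis (v \<bullet> x)"
      by (simp add: cis_conv_exp exp_sum[symmetric] euclidean_inner[of v x] sum_distrib_left)
    finally show ?thesis by (simp add: scaleR_conv_of_real)
  qed
  have m: "(\<lambda>f. \<Sum>b\<in>Basis. f b *\<^sub>R b) \<in> (\<Pi>\<^sub>M b\<in>(Basis :: (real^'n) set). (lborel :: real measure)) \<rightarrow>\<^sub>M borel"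
    by measurable
  have Fm: "F b \<in> borel_measurable borel" for b using intF[of b] by auto
  have "(\<integral>x. indicator torus x *\<^sub>R cis (v \<bullet> x) \<partial>lborel) = (\<integral>x. (\<Prod>b\<in>Basis. F b (x \<bullet> b)) \<partial>lborel)"
    by (simp add: prod)
  also have "\<dots> = (\<integral>f. (\<Prod>b\<in>Basis. F b ((\<Sum>b\<in>Basis. f b *\<^sub>R b) \<bullet> b)) \<partial>(\<Pi>\<^sub>M b\<in>(Basis :: (real^'n) set). lborel))"
    using Fm by (subst lborel_eq, subst integral_distr) (auto intro!: m borel_measurable_prod)
  also have "\<dots> = (\<integral>f. (\<Prod>b\<in>Basis. F b (f b)) \<partial>(\<Pi>\<^sub>M b\<in>(Basis :: (real^'n) set). lborel))"
    by (intro Bochner_Integration.integral_cong refl prod.cong) (simp_all add: inner_sum_left_Basis)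
  also have "\<dots> = (\<Prod>b\<in>Basis. integral\<^sup>L lborel (F b))"
    by (intro product_integral_prod intF) auto
  also have "\<dots> = (\<Prod>b\<in>(Basis :: (real^'n) set). if v \<bullet> b = 0 then of_real (2 * pi) else 0)"
    by (intro prod.cong refl) (use integral_cis_full_period[OF v] in \<open>auto simp: F_def[abs_def]\<close>)
  also have "\<dots> = (if v = 0 then of_real ((2 * pi) ^ CARD('n)) else 0)"
    using euclidean_eq_iff[of v 0] by (auto simp: prod_zero_iff)
  finally show ?thesis .
qed

lemma vec_of_Basis_Ints: "b \<in> Basis \<Longrightarrow> vec_of w \<bullet> b \<in> \<int>"
  by (auto simp: Basis_vec_def inner_axis)

abbreviation Tor :: "(real ^ 'n) measure" where "Tor \<equiv> restrict_space lborel torus"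

lemma torus_measurable [measurable]: "torus \<in> sets borel"
  by (simp add: torus_def)

lemma emeasure_torus: "emeasure lborel (torus :: (real^'n) set) = ennreal ((2 * pi) ^ CARD('n))"
proof -
  have *: "(pi *\<^sub>R One - - (pi *\<^sub>R One)) \<bullet> b = 2 * pi" if "b \<in> Basis" for b :: "real^'n"
    unfolding inner_diff_left inner_minus_left inner_scaleR_left using that by simp
  show ?thesis
    unfolding torus_def by (subst emeasure_lborel_cbox) (use * in \<open>auto simp del: diff_minus_eq_add\<close>)
qed

lemma finite_measure_Tor: "finite_measure (Tor :: (real^'n) measure)"
  by (intro finite_measureI) (simp add: emeasure_restrict_space space_restrict_space emeasure_torus)

lemma integral_Tor_cos:
  "(\<integral>\<theta>. cos (vec_of w \<bullet> \<theta>) \<partial>(Tor :: (real^'n) measure)) = (if w = 0 then (2 * pi) ^ CARD('n) else 0)"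
proof -
  have i: "integrable lborel (\<lambda>x. indicator torus x *\<^sub>R cis (vec_of w \<bullet> x))"
    unfolding torus_def by (intro borel_integrable_compact) (auto intro!: continuous_intros)
  have "(\<integral>\<theta>. cos (vec_of w \<bullet> \<theta>) \<partial>(Tor :: (real^'n) measure)) = (\<integral>x. indicator torus x *\<^sub>R cos (vec_of w \<bullet> x) \<partial>lborel)"
    by (simp add: integral_restrict_space)
  also have "\<dots> = Re (\<integral>x. indicator torus x *\<^sub>R cis (vec_of w \<bullet> x) \<partial>lborel)"
    using i by (subst integral_Re[symmetric]) auto
  also have "\<dots> = (if w = 0 then (2 * pi) ^ CARD('n) else 0)"
    by (subst integral_torus_cis) (auto intro: vec_of_Basis_Ints simp del: of_real_power of_real_mult)
  finally show ?thesis .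
qed

section \<open>The symbol, and Fourier inversion for the powers of A\<close>

lemma rw_intensitiesD:
  assumes "rw_intensities a"
  shows "\<And>z. z \<noteq> 0 \<Longrightarrow> a z \<ge> 0" "\<And>z. a (- z) = a z"
    "integrable (count_space UNIV) a" "(\<integral>z. a z \<partial>count_space UNIV) = 0"
proof -
  \<comment> \<open>For real families unconditional and absolute summability coincide, and the
    latter is Bochner integrability against counting measure.\<close>
  have s: "Infinite_Set_Sum.abs_summable_on a UNIV"
    using assms unfolding rw_intensities_def
    by (metis abs_summable_equivalent summable_on_iff_abs_summable_on_real)
  then show "integrable (count_space UNIV) a" by (simp add: abs_summable_on_def)
  show "(\<integral>z. a z \<partial>count_space UNIV) = 0"
    using infsetsum_infsum[OF s] assms by (simp add: infsetsum_def rw_intensities_def)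
qed (use assms in \<open>auto simp: rw_intensities_def\<close>)

lemma integrable_count_space_bounded_mult:
  fixes a g :: "'a \<Rightarrow> real"
  assumes "integrable (count_space UNIV) a" "\<And>z. \<bar>g z\<bar> \<le> B"
  shows "integrable (count_space UNIV) (\<lambda>z. a z * g z)"
  by (rule Bochner_Integration.integrable_bound[OF integrable_mult_left[where c=B, OF integrable_norm[OF assms(1)]]])
     (use assms(2) in \<open>auto simp: abs_mult intro!: AE_I2 mult_left_mono order.trans[OF assms(2) abs_ge_self]\<close>)

lemma infsum_eq_count_space_integral:
  fixes f :: "'a \<Rightarrow> real"
  assumes "integrable (count_space UNIV) f"
  shows "infsum f UNIV = (\<integral>z. f z \<partial>count_space UNIV)"
  using infsetsum_infsum[of f UNIV] assms by (simp add: infsetsum_def abs_summable_on_def)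

lemma symb_nonneg:
  assumes "\<And>z. z \<noteq> 0 \<Longrightarrow> a z \<ge> 0" shows "symb a \<theta> \<ge> 0"
  unfolding symb_def
proof (intro integral_nonneg_AE AE_I2)
  show "0 \<le> a z * (1 - cos (vec_of z \<bullet> \<theta>))" for z
    by (cases "z = 0") (use assms in auto)
qed

lemma continuous_symb:
  assumes "integrable (count_space UNIV) a" shows "continuous_on UNIV (symb a)"
proof -
  have "(\<lambda>n. symb a (x n)) \<longlonglongrightarrow> symb a l" if "x \<longlonglongrightarrow> l" for x l
    unfolding symb_def
  proof (rule integral_dominated_convergence[where w="\<lambda>z. \<bar>a z\<bar> * 2"])
    show "AE z in count_space UNIV. norm (a z * (1 - cos (vec_of z \<bullet> x n))) \<le> \<bar>a z\<bar> * 2" for n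
      by (intro AE_I2) (auto simp: abs_mult intro!: mult_left_mono order.trans[OF abs_triangle_ineq4] add_mono[of _ 1 _ 1, simplified])
    show "AE z in count_space UNIV. (\<lambda>n. a z * (1 - cos (vec_of z \<bullet> x n))) \<longlonglongrightarrow> a z * (1 - cos (vec_of z \<bullet> l))"
      by (intro AE_I2 tendsto_intros that)
  qed (use assms in auto)
  then show ?thesis by (auto simp: continuous_on_sequentially o_def)
qed

lemma symb_bound:
  assumes "integrable (count_space UNIV) a"
  shows "\<bar>symb a \<theta>\<bar> \<le> 2 * (\<integral>z. \<bar>a z\<bar> \<partial>count_space UNIV)"
proof -
  have c: "\<bar>1 - cos x\<bar> \<le> 2" for x :: real
    using cos_ge_minus_one[of x] cos_le_one[of x] by linarith
  have "norm (symb a \<theta>) \<le> (\<integral>z. \<bar>a z\<bar> * 2 \<partial>count_space UNIV)"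
    unfolding symb_def
    by (intro order.trans[OF integral_norm_bound integral_mono] integrable_norm integrable_count_space_bounded_mult[where B=2] c)
       (use assms in \<open>auto simp: abs_mult intro!: mult_left_mono c\<close>)
  then show ?thesis by simp
qed

lemma symb_measurable:
  assumes "integrable (count_space UNIV) a" shows "symb a \<in> borel_measurable borel"
  by (rule borel_measurable_continuous_onI[OF continuous_symb[OF assms]])

lemma integrable_Tor_bounded:
  fixes f :: "real ^ 'n \<Rightarrow> real" and B :: real
  assumes "f \<in> borel_measurable borel" "\<And>x. \<bar>f x\<bar> \<le> B"
  shows "integrable Tor f"
proof -
  interpret finite_measure "Tor :: (real^'n) measure" by (rule finite_measure_Tor)
  show ?thesis using assms by (intro integrable_const_bound[where B=B]) (auto intro!: measurable_restrict_space1)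
qed

text \<open>The sine part of the convolution vanishes by the symmetry of \<open>a\<close>.\<close>

lemma sum_cos_shift:
  assumes "rw_intensities a"
  shows "(\<integral>z. a z * cos (vec_of (w - z) \<bullet> \<theta>) \<partial>count_space UNIV) = - symb a \<theta> * cos (vec_of w \<bullet> \<theta>)"
proof -
  note rw = rw_intensitiesD[OF assms]
  have c: "integrable (count_space UNIV) (\<lambda>z. a z * cos (vec_of z \<bullet> \<theta>))"
   and s: "integrable (count_space UNIV) (\<lambda>z. a z * sin (vec_of z \<bullet> \<theta>))"
    by (auto intro!: integrable_count_space_bounded_mult[where B=1] rw)
  have "(\<integral>z. a z * sin (vec_of z \<bullet> \<theta>) \<partial>count_space UNIV) = (\<integral>z. a (- z) * sin (vec_of (- z) \<bullet> \<theta>) \<partial>count_space UNIV)"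
    by (rule integral_bij_count_space[symmetric]) (auto intro!: bij_betwI[where g=uminus])
  also have "\<dots> = - (\<integral>z. a z * sin (vec_of z \<bullet> \<theta>) \<partial>count_space UNIV)"
    by (simp add: rw)
  finally have s0: "(\<integral>z. a z * sin (vec_of z \<bullet> \<theta>) \<partial>count_space UNIV) = 0" by simp
  have sy: "symb a \<theta> = - (\<integral>z. a z * cos (vec_of z \<bullet> \<theta>) \<partial>count_space UNIV)"
    unfolding symb_def using c rw by (simp add: right_diff_distrib)
  have "(\<integral>z. a z * cos (vec_of (w - z) \<bullet> \<theta>) \<partial>count_space UNIV) =
    (\<integral>z. cos (vec_of w \<bullet> \<theta>) * (a z * cos (vec_of z \<bullet> \<theta>)) + sin (vec_of w \<bullet> \<theta>) * (a z * sin (vec_of z \<bullet> \<theta>)) \<partial>count_space UNIV)"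
    by (simp add: inner_diff_left cos_diff algebra_simps)
  also have "\<dots> = cos (vec_of w \<bullet> \<theta>) * (- symb a \<theta>)"
    using c s s0 sy by simp
  finally show ?thesis by simp
qed

text \<open>Convolution with \<open>a\<close> multiplies the Fourier transform by
  \<open>- symb a\<close>, so the n-th power of A has transform \<open>(- symb a) ^ n\<close>.
  General w is kept because the recursion for \<open>apow\<close> shifts the argument.\<close>

lemma apow_eq_integral:
  fixes a :: "int ^ 'n \<Rightarrow> real"
  assumes "rw_intensities a"
  shows "apow a n w = (\<integral>\<theta>. (- symb a \<theta>) ^ n * cos (vec_of w \<bullet> \<theta>) \<partial>Tor) / (2 * pi) ^ CARD('n)"
proof (induction n arbitrary: w)
  case 0
  then show ?case by (simp add: integral_Tor_cos)
next
  case (Suc n)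
  note rw = rw_intensitiesD[OF assms]
  interpret T: finite_measure "Tor :: (real^'n) measure" by (rule finite_measure_Tor)
  interpret S: sigma_finite_measure "count_space (UNIV :: (int^'n) set)"
    by (rule sigma_finite_measure_count_space_countable) simp
  interpret P: pair_sigma_finite "count_space (UNIV :: (int^'n) set)" "Tor :: (real^'n) measure" ..
  note [measurable] = symb_measurable[OF rw(3)]
  define C where "C = (2 * pi) ^ CARD('n)"
  define B where "B = (2 * (\<integral>z. \<bar>a z\<bar> \<partial>count_space UNIV)) ^ n"
  define g where "g z \<theta> = (- symb a \<theta>) ^ n * cos (vec_of (w - z) \<bullet> \<theta>)" for z \<theta>
  have gm [measurable]: "g z \<in> borel_measurable borel" for z unfolding g_def by measurable
  have gB: "\<bar>g z \<theta>\<bar> \<le> B" for z \<theta>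
    unfolding g_def B_def abs_mult power_abs
    by (rule order.trans[OF mult_mono[OF power_mono[of _ _ n] abs_cos_le_one]])
       (use symb_bound[OF rw(3), of \<theta>] in auto)
  have gi: "integrable Tor (g z)" for z by (rule integrable_Tor_bounded[OF gm gB])
  \<comment> \<open>Bounds uniform in z: against the summable \<open>a\<close> they yield
    integrability on the product space (\<open>gb\<close>) and convergence of the convolution sum
    (\<open>gb2\<close>).\<close>
  have gb: "\<bar>\<integral>\<theta>. \<bar>g z \<theta>\<bar> \<partial>Tor\<bar> \<le> (\<integral>\<theta>. B \<partial>(Tor :: (real^'n) measure))" for z
    using integral_mono[of Tor "\<lambda>\<theta>. \<bar>g z \<theta>\<bar>" "\<lambda>_. B"] gi gB by simp
  have gb2: "\<bar>\<integral>\<theta>. g z \<theta> \<partial>Tor\<bar> \<le> (\<integral>\<theta>. B \<partial>(Tor :: (real^'n) measure))" for z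
    using integral_abs_bound[of Tor "g z"] gb[of z] by linarith
  have "integrable (count_space UNIV \<Otimes>\<^sub>M Tor) (\<lambda>(z, \<theta>). a z * g z \<theta>)"
  proof (rule P.Fubini_integrable)
    show "(\<lambda>(z, \<theta>). a z * g z \<theta>) \<in> borel_measurable (count_space UNIV \<Otimes>\<^sub>M Tor)"
      by (rule measurable_pair_measure_countable1) (auto intro!: measurable_restrict_space1)
    show "integrable (count_space UNIV) (\<lambda>z. \<integral>\<theta>. norm (case (z, \<theta>) of (z, \<theta>) \<Rightarrow> a z * g z \<theta>) \<partial>Tor)"
      using integrable_count_space_bounded_mult[OF integrable_abs[OF rw(3)] gb] by (simp add: abs_mult)
    show "AE z in count_space UNIV. integrable Tor (\<lambda>\<theta>. case (z, \<theta>) of (z, \<theta>) \<Rightarrow> a z * g z \<theta>)"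
      using gi by simp
  qed
  from P.Fubini_integral[OF this]
  have sw: "(\<integral>\<theta>. (\<integral>z. a z * g z \<theta> \<partial>count_space UNIV) \<partial>Tor) = (\<integral>z. (\<integral>\<theta>. a z * g z \<theta> \<partial>Tor) \<partial>count_space UNIV)" .
  have "apow a (Suc n) w = (\<Sum>\<^sub>\<infinity>z. a z * (\<integral>\<theta>. g z \<theta> \<partial>Tor)) / C"
    unfolding apow.simps Suc.IH g_def C_def times_divide_eq_right by (simp only: divide_inverse infsum_cmult_left')
  also have "(\<Sum>\<^sub>\<infinity>z. a z * (\<integral>\<theta>. g z \<theta> \<partial>Tor)) = (\<integral>z. (\<integral>\<theta>. a z * g z \<theta> \<partial>Tor) \<partial>count_space UNIV)"
    by (subst infsum_eq_count_space_integral) (auto intro!: integrable_count_space_bounded_mult[OF rw(3) gb2])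
  also have "\<dots> = (\<integral>\<theta>. (\<integral>z. (- symb a \<theta>) ^ n * (a z * cos (vec_of (w - z) \<bullet> \<theta>)) \<partial>count_space UNIV) \<partial>Tor)"
    unfolding sw[symmetric] unfolding g_def by (simp only: mult.left_commute)
  also have "\<dots> = (\<integral>\<theta>. (- symb a \<theta>) ^ n * (\<integral>z. a z * cos (vec_of (w - z) \<bullet> \<theta>) \<partial>count_space UNIV) \<partial>Tor)"
    by (simp only: integral_mult_right_zero)
  also have "\<dots> = (\<integral>\<theta>. (- symb a \<theta>) ^ Suc n * cos (vec_of w \<bullet> \<theta>) \<partial>Tor)"
    by (subst sum_cos_shift[OF assms]) (simp add: mult_ac)
  finally show ?case by (simp add: C_def)
qed

text \<open>Summing the Fourier formulas of the powers gives the exponential series of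
  \<open>- t * symb a\<close>. Boundedness of the symbol by M majorises it by the series of exp (|t|
  M), which permits termwise integration over the torus.\<close>

lemma trans_prob_eq_integral:
  fixes a :: "int ^ 'n \<Rightarrow> real"
  assumes "rw_intensities a"
  shows "trans_prob a t 0 0 = (\<integral>\<theta>. exp (- (t * symb a \<theta>)) \<partial>Tor) / (2 * pi) ^ CARD('n)"
proof -
  note rw = rw_intensitiesD[OF assms]
  note [measurable] = symb_measurable[OF rw(3)]
  define M where "M = 2 * (\<integral>z. \<bar>a z\<bar> \<partial>count_space UNIV)"
  define f where "f n \<theta> = t ^ n / fact n * (- symb a \<theta>) ^ n" for n \<theta>
  have M0: "M \<ge> 0" by (simp add: M_def)
  interpret T: finite_measure "Tor :: (real^'n) measure" by (rule finite_measure_Tor)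
  have fm [measurable]: "f n \<in> borel_measurable borel" for n unfolding f_def by measurable
  have fB: "\<bar>f n \<theta>\<bar> \<le> (\<bar>t\<bar> * M) ^ n / fact n" for n \<theta>
    unfolding f_def abs_mult power_abs abs_divide power_mult_distrib
    using mult_left_mono[OF power_mono[OF symb_bound[OF rw(3), of \<theta>], of n], of "\<bar>t\<bar> ^ n"]
    by (auto simp: M_def[symmetric] divide_simps)
  have fi: "integrable Tor (f n)" for n by (rule integrable_Tor_bounded[OF fm fB])
  have ss: "summable (\<lambda>n. (\<bar>t\<bar> * M) ^ n / fact n)"
    using summable_exp[of "\<bar>t\<bar> * M"] by (simp add: field_simps)
  have e: "(\<Sum>n. f n \<theta>) = exp (- (t * symb a \<theta>))" for \<theta>
    unfolding exp_def f_def by (intro suminf_cong) (simp add: power_mult_distrib[symmetric] divide_inverse mult_ac)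
  have sums: "(\<lambda>n. \<integral>\<theta>. f n \<theta> \<partial>Tor) sums (\<integral>\<theta>. (\<Sum>n. f n \<theta>) \<partial>Tor)"
  proof (rule sums_integral[OF fi])
    show "AE \<theta> in Tor. summable (\<lambda>n. norm (f n \<theta>))"
      by (intro AE_I2 summable_comparison_test'[OF ss]) (use fB in auto)
    have "norm (\<integral>\<theta>. norm (f n \<theta>) \<partial>Tor) \<le> (\<bar>t\<bar> * M) ^ n / fact n * measure (Tor :: (real^'n) measure) (space Tor)" for n
      using integral_mono[of Tor "\<lambda>\<theta>. \<bar>f n \<theta>\<bar>" "\<lambda>_. (\<bar>t\<bar> * M) ^ n / fact n"] fi fB by (simp add: mult_ac)
    then show "summable (\<lambda>n. \<integral>\<theta>. norm (f n \<theta>) \<partial>Tor)"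
      by (intro summable_comparison_test'[OF summable_mult2[OF ss]])
  qed
  have "trans_prob a t 0 0 = (\<Sum>n. (\<integral>\<theta>. f n \<theta> \<partial>Tor) / (2 * pi) ^ CARD('n))"
    unfolding trans_prob_def f_def apow_eq_integral[OF assms] by simp
  also have "\<dots> = (\<Sum>n. (\<integral>\<theta>. f n \<theta> \<partial>Tor)) / (2 * pi) ^ CARD('n)"
    by (rule suminf_divide[OF sums_summable[OF sums]])
  also have "(\<Sum>n. (\<integral>\<theta>. f n \<theta> \<partial>Tor)) = (\<integral>\<theta>. exp (- (t * symb a \<theta>)) \<partial>Tor)"
    using sums_unique[OF sums] by (simp add: e)
  finally show ?thesis .
qed

subsection \<open>Lattice sums as integrals\<close>

text \<open>Index of the mesh cell containing x. For \<epsilon> > 0 the fibre over z is the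
  half-open cube of side \<epsilon> centred at \<epsilon> z, half-open because \<open>round\<close>
  sends ties upwards.\<close>

definition rnd :: "real \<Rightarrow> real ^ 'n \<Rightarrow> int ^ 'n" where
  "rnd \<epsilon> x = (\<chi> i. round (x $ i / \<epsilon>))"

lemma rnd_eq_iff:
  assumes "\<epsilon> > 0"
  shows "rnd \<epsilon> x = z \<longleftrightarrow> (\<forall>i. \<epsilon> * (real_of_int (z $ i) - 1 / 2) \<le> x $ i \<and> x $ i < \<epsilon> * (real_of_int (z $ i) + 1 / 2))"
proof -
  have "round (x $ i / \<epsilon>) = k \<longleftrightarrow> \<epsilon> * (real_of_int k - 1 / 2) \<le> x $ i \<and> x $ i < \<epsilon> * (real_of_int k + 1 / 2)" for i k
    unfolding round_def floor_eq_iff using assms by (auto simp: field_simps)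
  then show ?thesis by (simp add: rnd_def vec_eq_iff)
qed

lemma rnd_fiber_measurable [measurable]:
  assumes "\<epsilon> > 0" shows "{x. rnd \<epsilon> x = z} \<in> sets borel"
  unfolding rnd_eq_iff[OF assms] by measurable

lemma measurable_rnd:
  assumes "\<epsilon> > 0" shows "rnd \<epsilon> \<in> lborel \<rightarrow>\<^sub>M count_space UNIV"
  using rnd_fiber_measurable[OF assms]
  by (subst measurable_count_space_eq2_countable) (auto simp: vimage_def)

text \<open>The half-open cube lies between an open and a closed box of equal volume.\<close>

lemma emeasure_rnd_fiber:
  assumes "\<epsilon> > 0"
  shows "emeasure lborel {x :: real ^ 'n. rnd \<epsilon> x = z} = ennreal (\<epsilon> ^ CARD('n))"
proof -
  define l u :: "real ^ 'n" where "l = (\<chi> i. \<epsilon> * (real_of_int (z $ i) - 1 / 2))"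
    and "u = (\<chi> i. \<epsilon> * (real_of_int (z $ i) + 1 / 2))"
  have lu: "(u - l) \<bullet> b = \<epsilon>" if "b \<in> Basis" for b
    using that by (auto simp: Basis_vec_def inner_axis l_def u_def algebra_simps)
  have le: "l \<bullet> b \<le> u \<bullet> b" if "b \<in> Basis" for b
    using lu[OF that] assms by (simp add: inner_diff_left)
  have "box l u \<subseteq> {x. rnd \<epsilon> x = z}" "{x. rnd \<epsilon> x = z} \<subseteq> cbox l u"
    by (auto simp: rnd_eq_iff[OF assms] mem_box_cart l_def u_def less_imp_le)
  from emeasure_mono[OF this(1), of lborel] emeasure_mono[OF this(2), of lborel]
  show ?thesis using rnd_fiber_measurable[OF assms, of z] le lu
    by (intro antisym) auto
qed

text \<open>The image of Lebesgue measure under \<open>rnd \<epsilon>\<close> gives every lattice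
  point the mass of one cell, hence is a multiple of counting measure.\<close>

lemma integral_rnd:
  fixes f :: "int ^ 'n \<Rightarrow> real"
  assumes "\<epsilon> > 0"
  shows "(\<integral>x. f (rnd \<epsilon> x) \<partial>lborel) = \<epsilon> ^ CARD('n) * (\<integral>z. f z \<partial>count_space UNIV)"
proof -
  have "distr lborel (count_space UNIV) (rnd \<epsilon>) = density (count_space UNIV) (\<lambda>_ :: int ^ 'n. ennreal (\<epsilon> ^ CARD('n)))"
  proof (rule measure_eqI_countable[where A=UNIV])
    fix z :: "int ^ 'n"
    show "emeasure (distr lborel (count_space UNIV) (rnd \<epsilon>)) {z} = emeasure (density (count_space UNIV) (\<lambda>_. ennreal (\<epsilon> ^ CARD('n)))) {z}"
      using emeasure_rnd_fiber[OF assms, of z]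
      by (subst emeasure_distr[OF measurable_rnd[OF assms]]) (auto simp: vimage_def emeasure_density)
  qed auto
  then have "(\<integral>x. f (rnd \<epsilon> x) \<partial>lborel) = integral\<^sup>L (density (count_space UNIV) (\<lambda>_. ennreal (\<epsilon> ^ CARD('n)))) f"
    using integral_distr[OF measurable_rnd[OF assms], of f] by simp
  also have "\<dots> = \<epsilon> ^ CARD('n) * (\<integral>z. f z \<partial>count_space UNIV)"
    using assms by (subst integral_density) auto
  finally show ?thesis .
qed

lemma rnd_dist:
  assumes "\<epsilon> > 0"
  shows "\<bar>(\<epsilon> *\<^sub>R vec_of (rnd \<epsilon> x) - x) $ i\<bar> \<le> \<epsilon> / 2"
proof -
  have "\<bar>(\<epsilon> *\<^sub>R vec_of (rnd \<epsilon> x) - x) $ i\<bar> = \<epsilon> * \<bar>real_of_int (round (x $ i / \<epsilon>)) - x $ i / \<epsilon>\<bar>"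
    using assms by (simp add: rnd_def abs_mult[symmetric] right_diff_distrib)
      (metis (no_types, opaque_lifting) abs_mult abs_of_pos right_diff_distrib nonzero_mult_div_cancel_left times_divide_eq_right less_irrefl)
  also have "\<dots> \<le> \<epsilon> * (1 / 2)"
    using assms by (intro mult_left_mono of_int_round_abs_le) auto
  finally show ?thesis by simp
qed

lemma norm_rnd_dist:
  fixes x :: "real ^ 'n" and \<epsilon> :: real
  assumes "\<epsilon> > 0"
  shows "norm (\<epsilon> *\<^sub>R vec_of (rnd \<epsilon> x) - x) \<le> CARD('n) * \<epsilon>"
proof -
  have "norm (\<epsilon> *\<^sub>R vec_of (rnd \<epsilon> x) - x) \<le> (\<Sum>i\<in>UNIV. \<bar>(\<epsilon> *\<^sub>R vec_of (rnd \<epsilon> x) - x) $ i\<bar>)"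
    by (rule norm_le_l1_cart)
  also have "\<dots> \<le> (\<Sum>i\<in>(UNIV :: 'n set). \<epsilon>)"
    using rnd_dist[OF assms, of x] assms by (intro sum_mono) (smt (verit) field_sum_of_halves)
  finally show ?thesis by simp
qed

text \<open>A rounded coordinate is either 0 or at least \<epsilon> in absolute value; in the second
  case the error \<epsilon> / 2 is at most half of it. The factor 2 is thus independent of the
  mesh.\<close>

lemma norm_rnd_le:
  assumes "\<epsilon> > 0"
  shows "norm (\<epsilon> *\<^sub>R vec_of (rnd \<epsilon> x)) \<le> 2 * norm x"
proof -
  have "\<bar>(\<epsilon> *\<^sub>R vec_of (rnd \<epsilon> x)) $ i\<bar> \<le> \<bar>(2 *\<^sub>R x) $ i\<bar>" for i
  proof (cases "round (x $ i / \<epsilon>) = 0")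
    case True then show ?thesis by (simp add: rnd_def)
  next
    case False
    then have "1 \<le> \<bar>real_of_int (round (x $ i / \<epsilon>))\<bar>" by simp
    then have "\<epsilon> \<le> \<bar>(\<epsilon> *\<^sub>R vec_of (rnd \<epsilon> x)) $ i\<bar>"
      using assms by (simp add: rnd_def abs_mult)
    with rnd_dist[OF assms, of x i] show ?thesis
      unfolding vector_minus_component vector_scaleR_component by (simp only: real_scaleR_def)
  qed
  then have "norm (\<epsilon> *\<^sub>R vec_of (rnd \<epsilon> x)) \<le> norm (2 *\<^sub>R x)" by (intro norm_le_componentwise_cart) (simp only: real_norm_def)
  then show ?thesis by simp
qed

text \<open>Outside the cell of the origin the rounded point has norm at least \<epsilon>, which
  absorbs the rounding error. This allows negative powers at the rounded point to be replaced by
  negative powers at x.\<close>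

lemma norm_le_rnd:
  fixes x :: "real ^ 'n" and \<epsilon> :: real
  assumes "\<epsilon> > 0" "rnd \<epsilon> x \<noteq> 0"
  shows "norm x \<le> (1 + real CARD('n)) * norm (\<epsilon> *\<^sub>R vec_of (rnd \<epsilon> x))"
proof -
  have "\<epsilon> \<le> norm (\<epsilon> *\<^sub>R vec_of (rnd \<epsilon> x))"
    using norm_vec_of_ge_1[OF assms(2)] assms(1) by simp
  then have "CARD('n) * \<epsilon> \<le> CARD('n) * norm (\<epsilon> *\<^sub>R vec_of (rnd \<epsilon> x))"
    by (intro mult_left_mono) auto
  moreover have "norm x \<le> norm (\<epsilon> *\<^sub>R vec_of (rnd \<epsilon> x)) + norm (\<epsilon> *\<^sub>R vec_of (rnd \<epsilon> x) - x)"
    by (metis norm_triangle_sub norm_minus_commute)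
  ultimately show ?thesis using norm_rnd_dist[OF assms(1), of x]
    unfolding distrib_right mult_1 by linarith
qed

section \<open>An integrable majorant\<close>

text \<open>The quadratic cut-off at 0 reflects 1 - cos v <= v^2 / 2, and the power is the decay of
  \<open>a\<close>. With parameter 1 it also serves as a generic integrable tail.\<close>

definition levy_bound :: "real \<Rightarrow> real ^ 'n \<Rightarrow> real" where
  "levy_bound \<alpha> x = min 1 ((norm x)\<^sup>2) * norm x powr - (real CARD('n) + \<alpha>)"

lemma levy_bound_measurable [measurable]: "levy_bound \<alpha> \<in> borel_measurable borel"
  unfolding levy_bound_def by measurable

lemma levy_bound_nonneg: "levy_bound \<alpha> x \<ge> 0"
  by (simp add: levy_bound_def)

lemma nn_integral_min_powr_finite:
  assumes "0 < \<alpha>" "\<alpha> < 2"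
  shows "(\<integral>\<^sup>+t. ennreal (indicator {0<..} t * (min 1 (t\<^sup>2) * t powr (- 1 - \<alpha>))) \<partial>lborel) < \<infinity>"
proof -
  have 1: "(\<integral>\<^sup>+t. indicator {0..1} t * ennreal (t powr (1 - \<alpha>)) \<partial>lborel) < \<infinity>"
    using nn_integral_has_integral_lebesgue[OF _ has_integral_powr_from_0[of "1 - \<alpha>" 1]] assms
    by (simp add: ennreal_mult'' ennreal_indicator)
  have 2: "(\<integral>\<^sup>+t. indicator {1..} t * ennreal (t powr (- 1 - \<alpha>)) \<partial>lborel) < \<infinity>"
    using nn_integral_has_integral_lebesgue[OF _ has_integral_powr_to_inf[of "- 1 - \<alpha>" 1]] assms
    by (simp add: ennreal_mult'' ennreal_indicator)
  have p: "t\<^sup>2 * t powr (- 1 - \<alpha>) = t powr (1 - \<alpha>)" if "t > 0" for t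
    using that powr_add[of t 2 "-1-\<alpha>"] by (simp add: powr_numeral)
  have "(\<integral>\<^sup>+t. ennreal (indicator {0<..} t * (min 1 (t\<^sup>2) * t powr (- 1 - \<alpha>))) \<partial>lborel)
    \<le> (\<integral>\<^sup>+t. indicator {0..1} t * ennreal (t powr (1 - \<alpha>)) + indicator {1..} t * ennreal (t powr (- 1 - \<alpha>)) \<partial>lborel)"
  proof (rule nn_integral_mono)
    fix t :: real
    show "ennreal (indicator {0<..} t * (min 1 (t\<^sup>2) * t powr (- 1 - \<alpha>)))
      \<le> indicator {0..1} t * ennreal (t powr (1 - \<alpha>)) + indicator {1..} t * ennreal (t powr (- 1 - \<alpha>))"
    proof (cases "t > 0 \<and> t < 1")
      case True
      then have "min 1 (t\<^sup>2) = t\<^sup>2" by (simp add: power_le_one min.absorb2)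
      then show ?thesis using True p by simp
    next
      case False
      then show ?thesis by (auto simp: indicator_def power2_eq_square)
    qed
  qed
  also have "\<dots> = (\<integral>\<^sup>+t. indicator {0..1} t * ennreal (t powr (1 - \<alpha>)) \<partial>lborel) + (\<integral>\<^sup>+t. indicator {1..} t * ennreal (t powr (- 1 - \<alpha>)) \<partial>lborel)"
    by (rule nn_integral_add) auto
  also have "\<dots> < \<infinity>" using 1 2 by simp
  finally show ?thesis .
qed

lemma emeasure_cball_le:
  fixes t :: real assumes "t \<ge> 0"
  shows "emeasure lborel {x :: real ^ 'n. norm x \<le> t} \<le> ennreal ((2 * t) ^ CARD('n))"
proof -
  have *: "(t *\<^sub>R One - - (t *\<^sub>R One)) \<bullet> b = 2 * t" if "b \<in> Basis" for b :: "real^'n"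
    unfolding inner_diff_left inner_minus_left inner_scaleR_left using that by simp
  have "{x :: real ^ 'n. norm x \<le> t} \<subseteq> cbox (- (t *\<^sub>R One)) (t *\<^sub>R One)"
    using Basis_le_norm by (fastforce simp: mem_box abs_le_iff dest: order.trans)
  then have "emeasure lborel {x :: real ^ 'n. norm x \<le> t} \<le> emeasure lborel (cbox (- (t *\<^sub>R One)) (t *\<^sub>R One :: real ^ 'n))"
    by (rule emeasure_mono) simp
  also have "\<dots> = ennreal ((2 * t) ^ CARD('n))"
  proof -
    have le: "- (t *\<^sub>R One) \<bullet> b \<le> (t *\<^sub>R One) \<bullet> b" if "b \<in> Basis" for b :: "real ^ 'n"
      using assms that by simp
    have P: "(\<Prod>b\<in>(Basis :: (real ^ 'n) set). (t *\<^sub>R One - - (t *\<^sub>R One)) \<bullet> b) = (\<Prod>b\<in>(Basis :: (real ^ 'n) set). 2 * t)"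
      by (rule prod.cong[OF refl *])
    have "emeasure lborel (cbox (- (t *\<^sub>R One)) (t *\<^sub>R One :: real ^ 'n)) = ennreal (\<Prod>b\<in>(Basis :: (real ^ 'n) set). (t *\<^sub>R One - - (t *\<^sub>R One)) \<bullet> b)"
      by (rule emeasure_lborel_cbox) (rule le)
    then show ?thesis unfolding P by simp
  qed
  finally show ?thesis .
qed

text \<open>Instead of polar coordinates: \<open>levy_bound \<alpha> x\<close> is dominated by an integral over all radii
  \<open>t \<ge> norm x\<close>, which Tonelli turns into the volume of balls.\<close>

lemma integrable_levy_bound:
  assumes "0 < \<alpha>" "\<alpha> < 2"
  shows "integrable lborel (levy_bound \<alpha> :: real ^ 'n \<Rightarrow> real)"
proof (rule integrableI_bounded)
  show "(levy_bound \<alpha> :: real ^ 'n \<Rightarrow> real) \<in> borel_measurable lborel" by simp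
  define d where "d = real CARD('n)"
  \<comment> \<open>One power lower than in \<open>levy_bound\<close>: the interval [r, 2 r] has
    length r, so a lower bound \<open>levy_bound \<alpha> x / r\<close> on it integrates back to
    \<open>levy_bound \<alpha> x\<close>.\<close>
  define h where "h t = indicator {0<..} t * (min 1 (t\<^sup>2) * t powr (- 1 - \<alpha> - d))" for t :: real
  \<comment> \<open>The price of replacing r by 2 r in the decreasing power, so that the estimate
    holds for every t up to 2 r.\<close>
  define C where "C = 2 powr (1 + \<alpha> + d)"
  have hm [measurable]: "h \<in> borel_measurable borel" unfolding h_def by measurable
  have h0: "h t \<ge> 0" for t by (simp add: h_def)
  have C0: "C > 0" by (simp add: C_def)
  have pt: "ennreal (levy_bound \<alpha> x) \<le> (\<integral>\<^sup>+t. ennreal (C * h t * indicator {t. norm x \<le> t} t) \<partial>lborel)" for x :: "real ^ 'n"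
  proof (cases "x = 0")
    case True then show ?thesis by (simp add: levy_bound_def)
  next
    case False
    define r where "r = norm x"
    have r: "r > 0" using False by (simp add: r_def)
    have low: "levy_bound \<alpha> x / r \<le> C * h t" if "t \<in> {r..2 * r}" for t
    proof -
      have "levy_bound \<alpha> x / r = min 1 (r\<^sup>2) * (C * (2 * r) powr (- 1 - \<alpha> - d))"
        using r unfolding levy_bound_def C_def d_def r_def[symmetric]
        by (simp add: powr_mult powr_minus powr_add powr_diff field_simps)
      also have "\<dots> \<le> min 1 (t\<^sup>2) * (C * t powr (- 1 - \<alpha> - d))"
        using that r assms C0
        by (intro mult_mono mult_left_mono powr_mono2' min.mono power_mono) (auto simp: d_def)
      also have "\<dots> = C * h t" using that r by (simp add: h_def)
      finally show ?thesis .
    qed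
    have "ennreal (levy_bound \<alpha> x) = (\<integral>\<^sup>+t. ennreal (levy_bound \<alpha> x / r) * indicator {r..2 * r} t \<partial>lborel)"
      using r levy_bound_nonneg[of \<alpha> x] by (subst nn_integral_cmult_indicator) (auto simp: ennreal_mult[symmetric])
    also have "\<dots> \<le> (\<integral>\<^sup>+t. ennreal (C * h t * indicator {t. norm x \<le> t} t) \<partial>lborel)"
      using low by (intro nn_integral_mono) (auto simp: indicator_def r_def intro!: ennreal_leI)
    finally show ?thesis .
  qed
  have "(\<integral>\<^sup>+x. ennreal (norm (levy_bound \<alpha> (x :: real ^ 'n))) \<partial>lborel)
     \<le> (\<integral>\<^sup>+x. (\<integral>\<^sup>+t. ennreal (C * h t * indicator {t. norm (x :: real ^ 'n) \<le> t} t) \<partial>lborel) \<partial>lborel)"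
    by (intro nn_integral_mono) (simp only: real_norm_def abs_of_nonneg[OF levy_bound_nonneg] pt)
  also have "\<dots> = (\<integral>\<^sup>+t. (\<integral>\<^sup>+x. ennreal (C * h t * indicator {t. norm (x :: real ^ 'n) \<le> t} t) \<partial>lborel) \<partial>lborel)"
    by (rule lborel_pair.Fubini') (simp add: indicator_def[abs_def])
  also have "\<dots> = (\<integral>\<^sup>+t. ennreal (C * h t) * emeasure lborel {x :: real ^ 'n. norm x \<le> t} \<partial>lborel)"
  proof (rule nn_integral_cong)
    fix t :: real
    have "(\<integral>\<^sup>+x. ennreal (C * h t * indicator {t. norm (x :: real ^ 'n) \<le> t} t) \<partial>lborel)
      = (\<integral>\<^sup>+x. ennreal (C * h t) * indicator {x :: real ^ 'n. norm x \<le> t} x \<partial>lborel)"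
      by (intro nn_integral_cong) (auto simp: indicator_def)
    also have "\<dots> = ennreal (C * h t) * emeasure lborel {x :: real ^ 'n. norm x \<le> t}"
      by (rule nn_integral_cmult_indicator) simp
    finally show "(\<integral>\<^sup>+x. ennreal (C * h t * indicator {t. norm (x :: real ^ 'n) \<le> t} t) \<partial>lborel) = \<dots>" .
  qed
  also have "\<dots> \<le> (\<integral>\<^sup>+t. ennreal (C * 2 ^ CARD('n)) * ennreal (indicator {0<..} t * (min 1 (t\<^sup>2) * t powr (- 1 - \<alpha>))) \<partial>lborel)"
  proof (rule nn_integral_mono)
    fix t :: real
    show "ennreal (C * h t) * emeasure lborel {x :: real ^ 'n. norm x \<le> t}
       \<le> ennreal (C * 2 ^ CARD('n)) * ennreal (indicator {0<..} t * (min 1 (t\<^sup>2) * t powr (- 1 - \<alpha>)))"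
    proof (cases "t > 0")
      case True
      have "t powr (- 1 - \<alpha> - d) * t ^ CARD('n) = t powr (- 1 - \<alpha>)"
        using True powr_add[of t "- 1 - \<alpha> - d" d] by (simp add: powr_realpow d_def)
      then have eq: "C * h t * (2 * t) ^ CARD('n) = C * 2 ^ CARD('n) * (min 1 (t\<^sup>2) * t powr (- 1 - \<alpha>))"
        using True by (simp add: h_def power_mult_distrib mult_ac)
      have "ennreal (C * h t) * emeasure lborel {x :: real ^ 'n. norm x \<le> t} \<le> ennreal (C * h t) * ennreal ((2 * t) ^ CARD('n))"
        using True by (intro mult_left_mono emeasure_cball_le) auto
      also have "\<dots> = ennreal (C * h t * (2 * t) ^ CARD('n))"
        using True C0 h0 by (simp add: ennreal_mult)
      finally show ?thesis using True C0 unfolding eq by (simp add: ennreal_mult)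
    qed (simp add: h_def)
  qed
  also have "\<dots> = ennreal (C * 2 ^ CARD('n)) * (\<integral>\<^sup>+t. ennreal (indicator {0<..} t * (min 1 (t\<^sup>2) * t powr (- 1 - \<alpha>))) \<partial>lborel)"
    by (rule nn_integral_cmult) simp
  also have "\<dots> < \<infinity>"
    using nn_integral_min_powr_finite[OF assms] by (simp add: ennreal_mult_less_top)
  finally show "(\<integral>\<^sup>+x. ennreal (norm (levy_bound \<alpha> (x :: real ^ 'n))) \<partial>lborel) < \<infinity>" .
qed

text \<open>The exponential beats every power: one term y ^ m / m! of the series of exp y is enough.
  The resulting majorant is integrable by what is known about \<open>levy_bound 1\<close>, so no
  stretched exponential has to be integrated.\<close>

lemma exp_minus_powr_le_levy_bound:
  fixes c \<alpha> :: real
  assumes "c > 0" "\<alpha> > 0"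
  obtains C where "\<And>x :: real ^ 'n. exp (- (c * norm x powr \<alpha>)) \<le> indicator (cball 0 1) x + C * levy_bound 1 x"
proof
  define d where "d = real CARD('n)"
  \<comment> \<open>Chosen so that \<alpha> m >= d + 1, the decay of \<open>levy_bound 1\<close>
    outside the unit ball.\<close>
  define m where "m = nat \<lceil>(d + 1) / \<alpha>\<rceil>"
  fix x :: "real ^ 'n"
  show "exp (- (c * norm x powr \<alpha>)) \<le> indicator (cball 0 1) x + fact m / c ^ m * levy_bound 1 x"
  proof (cases "norm x \<le> 1")
    case True
    have "exp (- (c * norm x powr \<alpha>)) \<le> 1" using assms by simp
    also have "\<dots> \<le> indicator (cball 0 1) x + fact m / c ^ m * levy_bound 1 x"
      using True assms levy_bound_nonneg[of 1 x] by simp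
    finally show ?thesis .
  next
    case False
    define r where "r = norm x"
    have r: "r > 1" using False by (simp add: r_def)
    define y where "y = c * r powr \<alpha>"
    have y: "y > 0" using assms r by (simp add: y_def)
    have "(d + 1) / \<alpha> \<le> real m" unfolding m_def by linarith
    then have dm: "d + 1 \<le> \<alpha> * m" using assms by (simp add: field_simps)
    have "y ^ m / fact m \<le> exp y"
    proof -
      have "(\<lambda>n. y ^ n / fact n) sums exp y" using exp_converges[of y] by (simp add: field_simps)
      from sum_le_suminf[OF sums_summable[OF this], of "{m}"] sums_unique[OF this] y show ?thesis by simp
    qed
    then have "exp (- y) \<le> fact m / y ^ m" using y by (simp add: exp_minus field_simps)
    also have "y ^ m = c ^ m * r powr (\<alpha> * m)"
      using r by (simp add: y_def power_mult_distrib powr_realpow[symmetric] powr_powr)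
    also have "fact m / (c ^ m * r powr (\<alpha> * m)) \<le> fact m / (c ^ m * r powr (d + 1))"
      using assms r dm by (intro divide_left_mono mult_left_mono powr_mono) auto
    also have "r powr (d + 1) = inverse (levy_bound 1 x)"
      using r by (simp add: levy_bound_def r_def[symmetric] d_def powr_minus min.absorb1 del: minus_add_distrib)
    finally have "exp (- y) \<le> fact m / c ^ m * levy_bound 1 x" by (simp add: divide_simps)
    then show ?thesis using False by (simp add: y_def r_def)
  qed
qed

subsection \<open>Small-frequency behaviour of the symbol\<close>

lemma one_minus_cos_le: "1 - cos (v :: real) \<le> v\<^sup>2 / 2"
proof -
  have "\<bar>sin (v / 2)\<bar> \<le> \<bar>v / 2\<bar>" by (rule abs_sin_x_le_abs_x)
  then have "(sin (v / 2))\<^sup>2 \<le> (v / 2)\<^sup>2" by (metis abs_le_square_iff)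
  moreover have "cos v = 1 - 2 * (sin (v / 2))\<^sup>2" using cos_double_sin[of "v / 2"] by simp
  ultimately show ?thesis by (simp add: power2_eq_square field_simps)
qed

section \<open>The limiting Levy density and the scaling limit of the symbol\<close>

locale stable_rw =
  fixes a :: "int ^ 'n \<Rightarrow> real" and H :: "real ^ 'n \<Rightarrow> real" and \<alpha> :: real
  assumes rw: "rw_intensities a"
    and alpha: "0 < \<alpha>" "\<alpha> < 2"
    and H_cont: "continuous_on (sphere 0 1) H"
    and H_pos: "\<And>x. x \<in> sphere 0 1 \<Longrightarrow> H x > 0"
    and tail: "a \<sim>[cofinite] (\<lambda>z. H ((1 / norm (vec_of z)) *\<^sub>R vec_of z) / norm (vec_of z) powr (real CARD('n) + \<alpha>))"
begin

text \<open>Density of the Levy measure of the limiting stable law, homogeneous of degree - (d +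
  \<alpha>). Its value at 0 is 0 by the convention for division by zero.\<close>

definition levy :: "real ^ 'n \<Rightarrow> real" where
  "levy x = H ((1 / norm x) *\<^sub>R x) / norm x powr (real CARD('n) + \<alpha>)"

text \<open>Characteristic exponent, in cosine form, of the stable law with Levy density
  \<open>levy\<close>.\<close>

definition psi :: "real ^ 'n \<Rightarrow> real" where
  "psi u = (\<integral>x. levy x * (1 - cos (x \<bullet> u)) \<partial>lborel)"

definition ratio :: "int ^ 'n \<Rightarrow> real" where
  "ratio z = a z / levy (vec_of z)"

lemma levy_pos: "x \<noteq> 0 \<Longrightarrow> levy x > 0"
  unfolding levy_def by (intro divide_pos_pos H_pos) auto

text \<open>Asymptotic equivalence is defined by a quotient that is set to 1 where both functions
  vanish. Since \<open>levy\<close> is positive off the origin, this convention can matter only at z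
  = 0.\<close>

lemma ratio_tendsto: "(ratio \<longlongrightarrow> 1) cofinite"
proof -
  have "((\<lambda>z. if a z = 0 \<and> levy (vec_of z) = 0 then 1 else ratio z) \<longlongrightarrow> 1) cofinite"
    using tail unfolding asymp_equiv_def levy_def[symmetric] ratio_def .
  moreover have "eventually (\<lambda>z. (if a z = 0 \<and> levy (vec_of z) = 0 then 1 else ratio z) = ratio z) cofinite"
  proof (rule eventually_mono)
    show "eventually (\<lambda>z. z \<noteq> (0 :: int ^ 'n)) cofinite" by (simp add: eventually_cofinite)
  next
    fix z :: "int ^ 'n" assume "z \<noteq> 0"
    then show "(if a z = 0 \<and> levy (vec_of z) = 0 then 1 else ratio z) = ratio z"
      using levy_pos[of "vec_of z"] by auto
  qed
  ultimately show ?thesis by (rule Lim_transform_eventually)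
qed

lemma levy_scale:
  assumes "\<epsilon> > 0"
  shows "levy (\<epsilon> *\<^sub>R x) = \<epsilon> powr - (real CARD('n) + \<alpha>) * levy x"
  using assms unfolding levy_def powr_minus by (simp add: powr_mult field_simps)

lemma levy_tendsto:
  assumes "y \<longlonglongrightarrow> x" "x \<noteq> 0"
  shows "(\<lambda>n. levy (y n)) \<longlonglongrightarrow> levy x"
proof -
  have "eventually (\<lambda>n. y n \<noteq> 0) sequentially"
    using assms by (rule tendsto_imp_eventually_ne)
  then have "eventually (\<lambda>n. (1 / norm (y n)) *\<^sub>R y n \<in> sphere 0 1) sequentially"
    by eventually_elim auto
  moreover have "(\<lambda>n. (1 / norm (y n)) *\<^sub>R y n) \<longlonglongrightarrow> (1 / norm x) *\<^sub>R x"
    using assms by (intro tendsto_intros) auto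
  ultimately have "(\<lambda>n. H ((1 / norm (y n)) *\<^sub>R y n)) \<longlonglongrightarrow> H ((1 / norm x) *\<^sub>R x)"
    using assms by (intro continuous_on_tendsto_compose[OF H_cont]) auto
  then show ?thesis unfolding levy_def using assms by (intro tendsto_intros) auto
qed

text \<open>Off a finite set E the quotient is below 2, and H is bounded by compactness of the
  sphere; the finitely many points of E are absorbed into the constant A as a sum.\<close>

lemma tail_bound:
  obtains A where "A \<ge> 0" "\<And>z. z \<noteq> 0 \<Longrightarrow> a z \<le> A * norm (vec_of z) powr - (real CARD('n) + \<alpha>)"
proof -
  obtain h where h: "\<And>x. x \<in> sphere 0 1 \<Longrightarrow> H x \<le> h"
    using compact_imp_bounded[OF compact_continuous_image[OF H_cont compact_sphere]]
    unfolding bounded_iff by (metis image_eqI real_norm_def abs_le_iff)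
  define E where "E = {z :: int ^ 'n. \<not> ratio z < 2}"
  have E: "finite E"
    using order_tendstoD(2)[OF ratio_tendsto, of 2] by (simp add: E_def eventually_cofinite)
  define A where "A = 2 * \<bar>h\<bar> + (\<Sum>z\<in>E. \<bar>a z\<bar> * norm (vec_of z) powr (real CARD('n) + \<alpha>))"
  show ?thesis
  proof (rule that[of A])
    show "A \<ge> 0" unfolding A_def by (intro add_nonneg_nonneg sum_nonneg) auto
    fix z :: "int ^ 'n" assume z: "z \<noteq> 0"
    have "a z * norm (vec_of z) powr (real CARD('n) + \<alpha>) \<le> A"
    proof (cases "z \<in> E")
      case True
      have "a z * norm (vec_of z) powr (real CARD('n) + \<alpha>) \<le> \<bar>a z\<bar> * norm (vec_of z) powr (real CARD('n) + \<alpha>)"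
        by (intro mult_right_mono) auto
      also have "\<dots> \<le> (\<Sum>z\<in>E. \<bar>a z\<bar> * norm (vec_of z) powr (real CARD('n) + \<alpha>))"
        using True E by (intro member_le_sum) auto
      finally show ?thesis by (simp add: A_def)
    next
      case False
      have "a z \<le> 2 * levy (vec_of z)"
        using False levy_pos[of "vec_of z"] z by (simp add: E_def ratio_def field_simps)
      also have "levy (vec_of z) \<le> \<bar>h\<bar> / norm (vec_of z) powr (real CARD('n) + \<alpha>)"
        using z h[of "(1 / norm (vec_of z)) *\<^sub>R vec_of z"]
        unfolding levy_def by (intro divide_right_mono) auto
      finally have "a z * norm (vec_of z) powr (real CARD('n) + \<alpha>) \<le> 2 * \<bar>h\<bar>"
        using z by (simp add: field_simps)
      also have "\<dots> \<le> A" unfolding A_def by (simp add: sum_nonneg)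
      finally show ?thesis .
    qed
    then show "a z \<le> A * norm (vec_of z) powr - (real CARD('n) + \<alpha>)"
      using z unfolding powr_minus by (simp add: field_simps)
  qed
qed

text \<open>Rescaled so that the lattice sum defining \<open>symb a\<close> becomes an integral over \<open>x\<close>.\<close>

definition scaled :: "real \<Rightarrow> real ^ 'n \<Rightarrow> real ^ 'n \<Rightarrow> real" where
  "scaled \<epsilon> u x = \<epsilon> powr - (real CARD('n) + \<alpha>) * (a (rnd \<epsilon> x) * (1 - cos (vec_of (rnd \<epsilon> x) \<bullet> (\<epsilon> *\<^sub>R u))))"

text \<open>The cell volume \<epsilon> ^ d turns the prefactor of exponent - (d + \<alpha>) into one
  of exponent - \<alpha>.\<close>

lemma integral_scaled:
  assumes "\<epsilon> > 0"
  shows "(\<integral>x. scaled \<epsilon> u x \<partial>lborel) = \<epsilon> powr - \<alpha> * symb a (\<epsilon> *\<^sub>R u)"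
proof -
  have "\<epsilon> powr - (real CARD('n) + \<alpha>) * \<epsilon> ^ CARD('n) = \<epsilon> powr - \<alpha>"
    using assms by (simp add: powr_realpow[symmetric] powr_add[symmetric])
  then show ?thesis
    unfolding scaled_def integral_mult_right_zero
    by (subst integral_rnd[OF assms, of "\<lambda>z. a z * (1 - cos (vec_of z \<bullet> (\<epsilon> *\<^sub>R u)))"])
       (simp add: symb_def mult.assoc[symmetric])
qed

lemma scaled_measurable:
  assumes "\<epsilon> > 0"
  shows "scaled \<epsilon> u \<in> borel_measurable lborel"
  unfolding scaled_def
  using measurable_compose[OF measurable_rnd[OF assms], of "\<lambda>z. a z * (1 - cos (vec_of z \<bullet> (\<epsilon> *\<^sub>R u)))" borel]
  by (intro borel_measurable_times[OF borel_measurable_const]) simp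

text \<open>One constant serves every mesh \<epsilon>, because rounding changes norms only by fixed
  factors: A and D powr s come from \<open>tail_bound\<close> and \<open>norm_le_rnd\<close>, the
  factor 4 from \<open>norm_rnd_le\<close>.\<close>

lemma scaled_bound:
  assumes U: "U \<ge> 0"
  obtains B where "\<And>\<epsilon> u x. \<epsilon> > 0 \<Longrightarrow> norm u \<le> U \<Longrightarrow> \<bar>scaled \<epsilon> u x\<bar> \<le> B * levy_bound \<alpha> x"
proof -
  define s where "s = real CARD('n) + \<alpha>"
  have s: "s > 0" using alpha by (simp add: s_def add_nonneg_pos)
  obtain A where A: "A \<ge> 0" "\<And>z. z \<noteq> 0 \<Longrightarrow> a z \<le> A * norm (vec_of z) powr - s"
    using tail_bound unfolding s_def by blast
  define D where "D = 1 + real CARD('n)"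
  show ?thesis
  proof (rule that)
    fix \<epsilon> :: real and u x :: "real ^ 'n" assume \<epsilon>: "\<epsilon> > 0" and u: "norm u \<le> U"
    show "\<bar>scaled \<epsilon> u x\<bar> \<le> (A * D powr s * ((2 + U\<^sup>2) * 4)) * levy_bound \<alpha> x"
    \<comment> \<open>In the cell of the origin the step function vanishes, as 1 - cos 0 = 0; this
      also disposes of the negative value \<open>a 0\<close>.\<close>
    proof (cases "rnd \<epsilon> x = 0")
      case True
      then show ?thesis using A U levy_bound_nonneg[of \<alpha> x] by (simp add: scaled_def D_def)
    next
      case False
      define y where "y = \<epsilon> *\<^sub>R vec_of (rnd \<epsilon> x)"
      have y0: "y \<noteq> 0" using False \<epsilon> by (simp add: y_def)
      have yx: "norm y \<le> 2 * norm x" unfolding y_def by (rule norm_rnd_le[OF \<epsilon>])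
      have xy: "norm x \<le> D * norm y" unfolding y_def D_def by (rule norm_le_rnd[OF \<epsilon> False])
      have x0: "norm x > 0" using yx y0 by (smt (verit) norm_eq_zero norm_ge_zero)
      have a0: "a (rnd \<epsilon> x) \<ge> 0" using rw_intensitiesD(1)[OF rw False] .
      have "\<epsilon> powr - s * a (rnd \<epsilon> x) \<le> \<epsilon> powr - s * (A * norm (vec_of (rnd \<epsilon> x)) powr - s)"
        using A(2)[OF False] by (intro mult_left_mono) auto
      also have "\<dots> = A * norm y powr - s"
        using \<epsilon> by (simp add: y_def powr_mult)
      also have "\<dots> \<le> A * (norm x / D) powr - s"
        using xy x0 s A y0 by (intro mult_left_mono powr_mono2') (auto simp: D_def field_simps)
      also have "\<dots> = A * D powr s * norm x powr - s"
        using x0 by (simp add: powr_divide powr_minus D_def field_simps)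
      finally have b1: "\<epsilon> powr - s * a (rnd \<epsilon> x) \<le> A * D powr s * norm x powr - s" .
      \<comment> \<open>The summand U^2 covers small y through the quadratic bound, the summand 2
        covers large y.\<close>
      have "1 - cos (y \<bullet> u) \<le> (2 + U\<^sup>2) * min 1 ((norm y)\<^sup>2)"
      proof (cases "norm y \<le> 1")
        case True
        have "\<bar>y \<bullet> u\<bar> \<le> norm y * U"
          using Cauchy_Schwarz_ineq2[of y u] u by (meson mult_left_mono norm_ge_zero order_trans)
        then have "(y \<bullet> u)\<^sup>2 \<le> (norm y * U)\<^sup>2" using U by (metis abs_le_square_iff abs_of_nonneg mult_nonneg_nonneg norm_ge_zero)
        then have "1 - cos (y \<bullet> u) \<le> (norm y * U)\<^sup>2" using one_minus_cos_le[of "y \<bullet> u"] by (smt (verit) field_sum_of_halves zero_le_power2)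
        also have "\<dots> \<le> (2 + U\<^sup>2) * (norm y)\<^sup>2" by (simp add: power_mult_distrib algebra_simps)
        also have "(norm y)\<^sup>2 = min 1 ((norm y)\<^sup>2)" using True by (simp add: power_le_one min.absorb2)
        finally show ?thesis .
      next
        case False
        then have "min 1 ((norm y)\<^sup>2) = 1" by (simp add: min.absorb1)
        moreover have "1 - cos (y \<bullet> u) \<le> 2 + U\<^sup>2" using cos_ge_minus_one[of "y \<bullet> u"] by (smt (verit) zero_le_power2)
        ultimately show ?thesis by simp
      qed
      also have "\<dots> \<le> (2 + U\<^sup>2) * (4 * min 1 ((norm x)\<^sup>2))"
      proof (intro mult_left_mono)
        have "(norm y)\<^sup>2 \<le> 4 * (norm x)\<^sup>2" using power_mono[OF yx, of 2] by (simp add: power_mult_distrib)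
        then show "min 1 ((norm y)\<^sup>2) \<le> 4 * min 1 ((norm x)\<^sup>2)" by (simp add: min_def)
      qed simp
      finally have b2: "1 - cos (y \<bullet> u) \<le> (2 + U\<^sup>2) * (4 * min 1 ((norm x)\<^sup>2))" .
      have sc: "scaled \<epsilon> u x = (\<epsilon> powr - s * a (rnd \<epsilon> x)) * (1 - cos (y \<bullet> u))"
        by (simp add: scaled_def s_def y_def)
      have "\<bar>scaled \<epsilon> u x\<bar> = (\<epsilon> powr - s * a (rnd \<epsilon> x)) * (1 - cos (y \<bullet> u))"
        unfolding sc using a0 by (intro abs_of_nonneg mult_nonneg_nonneg) auto
      also have "\<dots> \<le> (A * D powr s * norm x powr - s) * ((2 + U\<^sup>2) * (4 * min 1 ((norm x)\<^sup>2)))"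
        using A by (intro mult_mono[OF b1 b2]) auto
      also have "\<dots> = (A * D powr s * ((2 + U\<^sup>2) * 4)) * levy_bound \<alpha> x"
        by (simp add: levy_bound_def s_def)
      finally show ?thesis .
    qed
  qed
qed

text \<open>For fixed x other than 0 the rescaled lattice points tend to x, so the unscaled ones
  leave every finite set and \<open>ratio\<close> tends to 1 along them. Homogeneity of
  \<open>levy\<close> cancels the power of \<epsilon>.\<close>

lemma scaled_tendsto:
  assumes e: "\<And>n. \<epsilon> n > 0" "\<epsilon> \<longlonglongrightarrow> 0" and u: "u \<longlonglongrightarrow> v"
  shows "(\<lambda>n. scaled (\<epsilon> n) (u n) x) \<longlonglongrightarrow> levy x * (1 - cos (x \<bullet> v))"
proof (cases "x = 0")
  case True
  have "rnd (\<epsilon> n) x = 0" for n by (simp add: rnd_def vec_eq_iff True)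
  then show ?thesis using True by (simp add: scaled_def)
next
  case False
  define z where "z n = rnd (\<epsilon> n) x" for n
  define y where "y n = \<epsilon> n *\<^sub>R vec_of (z n)" for n
  have "(\<lambda>n. y n - x) \<longlonglongrightarrow> 0"
    by (rule Lim_null_comparison[where g="\<lambda>n. real CARD('n) * \<epsilon> n"])
       (use norm_rnd_dist[OF e(1), of _ x] tendsto_mult_right_zero[OF e(2)] in \<open>auto simp: y_def z_def\<close>)
  then have y: "y \<longlonglongrightarrow> x" by (simp add: LIM_zero_iff)
  have ninf: "filterlim (\<lambda>n. norm (vec_of (z n))) at_top sequentially"
  proof -
    have "filterlim (\<lambda>n. norm (y n) / \<epsilon> n) at_top sequentially"
      using tendsto_norm[OF y] e False by (intro LIM_at_top_divide[of _ "norm x"]) auto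
    moreover have "norm (y n) / \<epsilon> n = norm (vec_of (z n))" for n using e(1)[of n] by (simp add: y_def)
    ultimately show ?thesis by simp
  qed
  have zc: "filterlim z cofinite sequentially"
    unfolding filterlim_iff
  proof (intro allI impI)
    fix P :: "int ^ 'n \<Rightarrow> bool" assume "eventually P cofinite"
    then have fin: "finite {w. \<not> P w}" by (simp add: eventually_cofinite)
    \<comment> \<open>The sum of all norms over the finite exceptional set exceeds each of them, so
      a larger norm certifies that the point lies outside the set.\<close>
    have "eventually (\<lambda>n. (\<Sum>w\<in>{w. \<not> P w}. norm (vec_of w)) < norm (vec_of (z n))) sequentially"
      using ninf by (simp add: filterlim_at_top_dense)
    then show "eventually (\<lambda>n. P (z n)) sequentially"
    proof eventually_elim
      case (elim n)
      show ?case
      proof (rule ccontr)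
        assume "\<not> P (z n)"
        then have "norm (vec_of (z n)) \<le> (\<Sum>w\<in>{w. \<not> P w}. norm (vec_of w))"
          using fin by (intro member_le_sum) auto
        with elim show False by simp
      qed
    qed
  qed
  have r: "(\<lambda>n. ratio (z n)) \<longlonglongrightarrow> 1" by (rule filterlim_compose[OF ratio_tendsto zc])
  have "(\<lambda>n. ratio (z n) * levy (y n) * (1 - cos (y n \<bullet> u n))) \<longlonglongrightarrow> 1 * levy x * (1 - cos (x \<bullet> v))"
    by (intro tendsto_intros r y u levy_tendsto False)
  moreover have "eventually (\<lambda>n. ratio (z n) * levy (y n) * (1 - cos (y n \<bullet> u n)) = scaled (\<epsilon> n) (u n) x) sequentially"
    using tendsto_imp_eventually_ne[OF y False]
  proof eventually_elim
    case (elim n)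
    then have "levy (vec_of (z n)) > 0" by (intro levy_pos) (auto simp: y_def)
    moreover have "levy (y n) = \<epsilon> n powr - (real CARD('n) + \<alpha>) * levy (vec_of (z n))"
      unfolding y_def by (rule levy_scale[OF e(1)])
    ultimately show ?case by (simp add: ratio_def scaled_def y_def z_def)
  qed
  ultimately show ?thesis using Lim_transform_eventually by fastforce
qed

text \<open>H is controlled only on the sphere, so measurability is obtained from the pointwise
  limit of the measurable step functions.\<close>

lemma levy_cos_measurable: "(\<lambda>x. levy x * (1 - cos (x \<bullet> v))) \<in> borel_measurable lborel"
  by (rule borel_measurable_LIMSEQ_real[OF scaled_tendsto[where \<epsilon>="\<lambda>n. inverse (real (Suc n))" and u="\<lambda>_. v"]])
     (auto intro!: scaled_measurable[unfolded measurable_lborel2] LIMSEQ_inverse_real_of_nat simp del: of_nat_Suc)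

text \<open>Dominated convergence along arbitrary sequences \<epsilon> and u. Letting u vary is the
  sequential form of local uniformity, required by \<open>symb_lower_bound\<close>, where the
  directions change with n.\<close>

lemma
  assumes e: "\<And>n. \<epsilon> n > 0" "\<epsilon> \<longlonglongrightarrow> 0" and u: "u \<longlonglongrightarrow> v"
  shows symb_scaled_tendsto: "(\<lambda>n. \<epsilon> n powr - \<alpha> * symb a (\<epsilon> n *\<^sub>R u n)) \<longlonglongrightarrow> psi v"
    and integrable_levy_cos: "integrable lborel (\<lambda>x. levy x * (1 - cos (x \<bullet> v)))"
proof -
  obtain U where U: "\<And>n. norm (u n) \<le> U"
    using convergent_imp_Bseq[of u] u by (auto simp: convergent_def Bseq_def)
  have U0: "U \<ge> 0" using order.trans[OF norm_ge_zero U] .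
  obtain B where B: "\<And>\<epsilon> u x. \<epsilon> > 0 \<Longrightarrow> norm u \<le> U \<Longrightarrow> \<bar>scaled \<epsilon> u x\<bar> \<le> B * levy_bound \<alpha> x"
    using scaled_bound[OF U0] by blast
  have dom: "AE x in lborel. norm (scaled (\<epsilon> n) (u n) x) \<le> B * levy_bound \<alpha> x" for n
    using B[OF e(1) U] by simp
  have w: "integrable lborel (\<lambda>x. B * levy_bound \<alpha> x)"
    by (intro integrable_mult_right integrable_levy_bound alpha)
  have lim: "AE x in lborel. (\<lambda>n. scaled (\<epsilon> n) (u n) x) \<longlonglongrightarrow> levy x * (1 - cos (x \<bullet> v))"
    using scaled_tendsto[OF e u] by simp
  show "integrable lborel (\<lambda>x. levy x * (1 - cos (x \<bullet> v)))"
    by (rule integrable_dominated_convergence[OF levy_cos_measurable scaled_measurable[OF e(1)] w lim dom])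
  show "(\<lambda>n. \<epsilon> n powr - \<alpha> * symb a (\<epsilon> n *\<^sub>R u n)) \<longlonglongrightarrow> psi v"
    using integral_dominated_convergence[OF levy_cos_measurable scaled_measurable[OF e(1)] w lim dom]
    by (simp add: integral_scaled[OF e(1)] psi_def)
qed

text \<open>A vanishing integral of a nonnegative function would force cos (x . v) = 1 almost
  everywhere, but the set S where this fails is open and nonempty.\<close>

lemma psi_pos:
  assumes "v \<noteq> 0" shows "psi v > 0"
proof -
  have i: "integrable lborel (\<lambda>x. levy x * (1 - cos (x \<bullet> v)))"
    by (rule integrable_levy_cos[where \<epsilon>="\<lambda>n. inverse (real (Suc n))" and u="\<lambda>_. v"])
       (auto intro!: LIMSEQ_inverse_real_of_nat simp del: of_nat_Suc)
  have nn: "0 \<le> levy x * (1 - cos (x \<bullet> v))" for x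
    by (cases "x = 0") (use levy_pos[of x] in auto)
  define S where "S = {x. cos (x \<bullet> v) < 1}"
  \<comment> \<open>At this point the inner product with v equals pi, so the cosine is - 1.\<close>
  have "(pi / (v \<bullet> v)) *\<^sub>R v \<in> S" using assms by (simp add: S_def)
  moreover have "open S" unfolding S_def by (intro open_Collect_less continuous_intros)
  ultimately have "\<not> negligible S" using open_not_negligible by blast
  have "psi v \<noteq> 0"
  proof
    assume "psi v = 0"
    then have "AE x in lborel. levy x * (1 - cos (x \<bullet> v)) = 0"
      using integral_nonneg_eq_0_iff_AE[OF i] nn by (simp add: psi_def)
    then have "AE x in lborel. x \<notin> S"
    proof eventually_elim
      case (elim x)
      then show ?case using levy_pos[of x] by (cases "x = 0") (auto simp: S_def)
    qed
    then have "S \<in> null_sets lborel"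
      using \<open>open S\<close> by (subst (asm) AE_iff_null_sets[symmetric]) auto
    then have "negligible S"
      using negligible_iff_null_sets null_sets_completionI by blast
    with \<open>\<not> negligible S\<close> show False by simp
  qed
  moreover have "psi v \<ge> 0" unfolding psi_def using nn by (intro integral_nonneg_AE) simp
  ultimately show ?thesis by simp
qed

end

subsection \<open>Local limit theorem\<close>

lemma abs_torus_component_le: "\<theta> \<in> torus \<Longrightarrow> \<bar>\<theta> $ i\<bar> \<le> pi"
  by (auto simp: torus_def mem_box axis_in_Basis_iff dest!: bspec[of _ _ "axis i 1"])
     (simp add: inner_axis abs_le_iff)

context stable_rw
begin

text \<open>Irreducibility: a zero of the symbol makes z . \<theta> a multiple of 2 pi for every z
  with \<open>a z\<close> nonzero, a condition stable under addition, hence for all z. Unit vectors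
  z then give \<theta> = 0, since the coordinates of \<theta> are at most pi in absolute
  value.\<close>

lemma symb_pos:
  assumes "\<theta> \<in> torus" "\<theta> \<noteq> 0"
  shows "symb a \<theta> > 0"
proof -
  note D = rw_intensitiesD[OF rw]
  have int: "integrable (count_space UNIV) (\<lambda>z. a z * (1 - cos (vec_of z \<bullet> \<theta>)))"
    by (rule integrable_count_space_bounded_mult[OF D(3), where B=2]) (smt (verit) cos_ge_minus_one cos_le_one)
  have nn: "0 \<le> a z * (1 - cos (vec_of z \<bullet> \<theta>))" for z
    by (cases "z = 0") (use D(1) in auto)
  have "symb a \<theta> \<noteq> 0"
  proof
    assume "symb a \<theta> = 0"
    then have "AE z in count_space UNIV. a z * (1 - cos (vec_of z \<bullet> \<theta>)) = 0"
      using integral_nonneg_eq_0_iff_AE[OF int] nn by (simp add: symb_def)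
    then have *: "a z \<noteq> 0 \<Longrightarrow> cos (vec_of z \<bullet> \<theta>) = 1" for z
      by (auto simp: AE_count_space)
    have "cos (vec_of (sum_list zs) \<bullet> \<theta>) = 1" if "\<forall>w\<in>set zs. a w \<noteq> 0" for zs
      using that
    proof (induction zs)
      case (Cons w zs)
      have "vec_of (w + sum_list zs) = vec_of w + vec_of (sum_list zs)" by (simp add: vec_eq_iff)
      \<comment> \<open>cos = 1 forces sin = 0, so the addition formula for the cosine carries the
        property to sums.\<close>
      moreover have "sin (vec_of w \<bullet> \<theta>) = 0" using *[of w] Cons.prems
        by (metis cos_one_sin_zero list.set_intros(1))
      ultimately show ?case using Cons * by (simp add: inner_add_left cos_add)
    qed simp
    then have c1: "cos (vec_of z \<bullet> \<theta>) = 1" for z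
      using rw unfolding rw_intensities_def by metis
    have "\<theta> $ i = 0" for i
    proof -
      have "vec_of (axis i 1) = axis i (1 :: real)" by (simp add: vec_eq_iff axis_def)
      then have "cos (\<theta> $ i) = 1" using c1[of "axis i 1"] by (simp add: inner_axis')
      moreover have "\<bar>\<theta> $ i\<bar> \<le> pi" by (rule abs_torus_component_le[OF assms(1)])
      ultimately show ?thesis
        using cos_monotone_0_pi[of 0 "\<bar>\<theta> $ i\<bar>"] by (cases "\<theta> $ i = 0") (auto simp: cos_abs_real)
    qed
    with assms(2) show False by (simp add: vec_eq_iff)
  qed
  moreover have "symb a \<theta> \<ge> 0" by (rule symb_nonneg[OF D(1)])
  ultimately show ?thesis by simp
qed

text \<open>A sequence of counterexamples with constants 1 / (n + 1) has a limit point l in the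
  torus. If l is nonzero, continuity contradicts \<open>symb_pos\<close>; if l = 0, the scaling
  limit contradicts \<open>psi_pos\<close>.\<close>

lemma symb_lower_bound:
  obtains c where "c > 0" "\<And>\<theta>. \<theta> \<in> torus \<Longrightarrow> symb a \<theta> \<ge> c * norm \<theta> powr \<alpha>"
proof (rule ccontr)
  note D = rw_intensitiesD[OF rw]
  assume "\<not> thesis"
  then have "\<exists>\<theta>\<in>torus. symb a \<theta> < inverse (real (Suc n)) * norm \<theta> powr \<alpha>" for n
    using that[of "inverse (real (Suc n))"] by (force simp: not_le)
  then obtain \<theta> where \<theta>: "\<And>n. \<theta> n \<in> torus" "\<And>n. symb a (\<theta> n) < inverse (real (Suc n)) * norm (\<theta> n) powr \<alpha>"
    by metis
  have "compact (torus :: (real ^ 'n) set)" by (simp add: torus_def)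
  then obtain l r where l: "l \<in> torus" "strict_mono r" "(\<theta> \<circ> r) \<longlonglongrightarrow> l"
    using \<theta>(1) unfolding compact_def by metis
  have inv0: "(\<lambda>n. inverse (real (Suc (q n)))) \<longlonglongrightarrow> 0" if "strict_mono q" for q
    using LIMSEQ_subseq_LIMSEQ[OF LIMSEQ_inverse_real_of_nat that] by (simp add: o_def)
  have th0: "\<theta> n \<noteq> 0" for n
    using \<theta>(2)[of n] symb_nonneg[of a, OF D(1), where \<theta>="\<theta> n"] by auto
  show False
  proof (cases "l = 0")
    case False
    have "(\<lambda>n. inverse (real (Suc (r n))) * norm ((\<theta> \<circ> r) n) powr \<alpha>) \<longlonglongrightarrow> 0 * norm l powr \<alpha>"
      using False by (intro tendsto_intros inv0 l) auto
    moreover have "(\<lambda>n. symb a ((\<theta> \<circ> r) n)) \<longlonglongrightarrow> symb a l"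
      using continuous_symb[OF D(3)] l(3) by (auto simp: continuous_on_sequentially o_def)
    moreover have "symb a ((\<theta> \<circ> r) n) \<le> inverse (real (Suc (r n))) * norm ((\<theta> \<circ> r) n) powr \<alpha>" for n
      using less_imp_le[OF \<theta>(2)[of "r n"]] by simp
    ultimately have "symb a l \<le> 0 * norm l powr \<alpha>"
      using LIMSEQ_le by blast
    with symb_pos[OF l(1) False] show False by simp
  next
    case True
    \<comment> \<open>Polar decomposition of the sequence: the norms play the role of \<epsilon>,
      and the directions converge along a further subsequence.\<close>
    define u where "u n = (1 / norm (\<theta> (r n))) *\<^sub>R \<theta> (r n)" for n
    have "u n \<in> sphere 0 1" for n using th0 by (simp add: u_def)
    then obtain v q where v: "v \<in> sphere 0 1" "strict_mono q" "(u \<circ> q) \<longlonglongrightarrow> v"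
      using compact_sphere[of "0 :: real ^ 'n" 1] unfolding compact_def by metis
    define \<epsilon> where "\<epsilon> n = norm (\<theta> (r (q n)))" for n
    have e0: "\<epsilon> n > 0" for n using th0 by (simp add: \<epsilon>_def)
    have eps: "\<epsilon> \<longlonglongrightarrow> 0"
      using tendsto_norm[OF LIMSEQ_subseq_LIMSEQ[OF l(3) v(2)]] True by (simp add: \<epsilon>_def[abs_def] o_def)
    have "\<epsilon> n *\<^sub>R (u \<circ> q) n = \<theta> (r (q n))" for n using th0 by (simp add: \<epsilon>_def u_def)
    then have "\<epsilon> n powr - \<alpha> * symb a (\<epsilon> n *\<^sub>R (u \<circ> q) n) \<le> inverse (real (Suc ((r \<circ> q) n)))" for n
      using \<theta>(2)[of "r (q n)"] e0[of n] by (simp add: \<epsilon>_def powr_minus field_simps)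
    moreover have "(\<lambda>n. \<epsilon> n powr - \<alpha> * symb a (\<epsilon> n *\<^sub>R (u \<circ> q) n)) \<longlonglongrightarrow> psi v"
      by (rule symb_scaled_tendsto[OF e0 eps v(3)])
    moreover have "(\<lambda>n. inverse (real (Suc ((r \<circ> q) n)))) \<longlonglongrightarrow> 0"
      by (intro inv0 strict_mono_o l v)
    ultimately have "psi v \<le> 0"
      using LIMSEQ_le[of _ "psi v"] by blast
    moreover have "v \<noteq> 0" using v(1) by auto
    ultimately show False using psi_pos by force
  qed
qed

lemma integral_scaled_torus:
  fixes f :: "real ^ 'n \<Rightarrow> real"
  assumes [measurable]: "f \<in> borel_measurable borel" and "\<epsilon> > 0"
  shows "(\<integral>\<theta>. f \<theta> \<partial>Tor) = \<epsilon> ^ CARD('n) * (\<integral>u. indicator torus (\<epsilon> *\<^sub>R u) * f (\<epsilon> *\<^sub>R u) \<partial>lborel)"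
proof -
  have "(\<integral>\<theta>. f \<theta> \<partial>Tor) = (\<integral>\<theta>. indicator torus \<theta> * f \<theta> \<partial>lborel)"
    by (simp add: integral_restrict_space)
  also have "\<dots> = (\<integral>\<theta>. indicator torus \<theta> * f \<theta> \<partial>density (distr lborel borel (\<lambda>x. 0 + \<epsilon> *\<^sub>R x)) (\<lambda>_. \<bar>\<epsilon>\<bar> ^ DIM(real ^ 'n)))"
    using lborel_affine[of \<epsilon> "0 :: real ^ 'n"] assms by simp
  also have "\<dots> = \<epsilon> ^ CARD('n) * (\<integral>u. indicator torus (\<epsilon> *\<^sub>R u) * f (\<epsilon> *\<^sub>R u) \<partial>lborel)"
    using assms by (subst integral_density) (auto simp: integral_distr)
  finally show ?thesis .
qed

text \<open>The substitution \<theta> = t powr (- 1 / \<alpha>) u makes t times the symbol converge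
  to \<open>psi u\<close>. The constant C is the Fourier integral for the density at 0 of the
  limiting stable law.\<close>

lemma trans_prob_asymp:
  obtains C where "C > 0" "((\<lambda>t. t powr (CARD('n) / \<alpha>) * trans_prob a t 0 0) \<longlongrightarrow> C) at_top"
proof -
  note D = rw_intensitiesD[OF rw]
  note [measurable] = symb_measurable[OF D(3)]
  obtain c where c: "c > 0" "\<And>\<theta>. \<theta> \<in> torus \<Longrightarrow> symb a \<theta> \<ge> c * norm \<theta> powr \<alpha>"
    by (rule symb_lower_bound) blast
  obtain B where B: "\<And>x :: real ^ 'n. exp (- (c * norm x powr \<alpha>)) \<le> indicator (cball 0 1) x + B * levy_bound 1 x"
    using exp_minus_powr_le_levy_bound[OF c(1) alpha(1)] by blast
  define eps where "eps t = t powr - (1 / \<alpha>)" for t :: real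
  define F where "F t u = indicator torus (eps t *\<^sub>R u) * exp (- (t * symb a (eps t *\<^sub>R u)))" for t and u :: "real ^ 'n"
  define w where "w u = indicator (cball 0 1) u + B * levy_bound 1 u" for u :: "real ^ 'n"
  have e0: "eps t > 0" if "t > 0" for t using that by (simp add: eps_def)
  have e\<alpha>: "eps t powr - \<alpha> = t" if "t > 0" for t using that alpha by (simp add: eps_def powr_powr)
  have et: "(eps \<longlongrightarrow> 0) at_top"
    unfolding eps_def using alpha by (intro tendsto_neg_powr filterlim_ident) auto
  have Fm [measurable]: "F t \<in> borel_measurable lborel" for t unfolding F_def by measurable
  have wi: "integrable lborel w"
    unfolding w_def
    by (intro Bochner_Integration.integrable_add integrable_mult_right integrable_levy_bound)
       (auto intro!: integrable_real_indicator emeasure_bounded_finite)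
  have Fw: "norm (F t u) \<le> w u" if "t > 0" for t u
  proof -
    have "F t u \<le> exp (- (c * norm u powr \<alpha>))"
    proof (cases "eps t *\<^sub>R u \<in> torus")
      case True
      have "t * (c * norm (eps t *\<^sub>R u) powr \<alpha>) = c * norm u powr \<alpha> * (t * eps t powr \<alpha>)"
        using e0[OF that] by (simp add: powr_mult)
      also have "t * eps t powr \<alpha> = 1" using e\<alpha>[OF that] that e0[OF that] by (simp add: powr_minus field_simps)
      finally have "t * (c * norm (eps t *\<^sub>R u) powr \<alpha>) = c * norm u powr \<alpha>" by simp
      then have "c * norm u powr \<alpha> \<le> t * symb a (eps t *\<^sub>R u)"
        using mult_left_mono[OF c(2)[OF True], of t] that by linarith
      then show ?thesis using True by (simp add: F_def)
    qed (simp add: F_def)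
    then show ?thesis using B[of u] by (simp add: w_def F_def)
  qed
  have lim: "((\<lambda>t. F t u) \<longlongrightarrow> exp (- psi u)) at_top" for u
  proof (rule tendsto_at_topI_sequentially)
    fix X :: "nat \<Rightarrow> real" assume X: "filterlim X at_top sequentially"
    then obtain N where N: "\<And>n. n \<ge> N \<Longrightarrow> X n > 0"
      using filterlim_at_top_dense[of X sequentially] eventually_sequentially by metis
    \<comment> \<open>The shift makes every member of the sequence positive, as the scaling limit
      demands of all \<epsilon> n.\<close>
    define Y where "Y n = X (n + N)" for n
    have Y0: "Y n > 0" for n using N by (simp add: Y_def)
    have Y: "filterlim Y at_top sequentially"
      unfolding Y_def using X by (rule filterlim_compose) (rule filterlim_add_const_nat_at_top)
    have ey: "(\<lambda>n. eps (Y n)) \<longlonglongrightarrow> 0" by (rule filterlim_compose[OF et Y])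
    have "(\<lambda>n. eps (Y n) powr - \<alpha> * symb a (eps (Y n) *\<^sub>R u)) \<longlonglongrightarrow> psi u"
      by (rule symb_scaled_tendsto[OF e0[OF Y0] ey tendsto_const])
    then have "(\<lambda>n. exp (- (Y n * symb a (eps (Y n) *\<^sub>R u)))) \<longlonglongrightarrow> exp (- psi u)"
      by (intro tendsto_intros) (simp add: e\<alpha>[OF Y0])
    \<comment> \<open>For fixed u the rescaled argument is eventually inside the torus, so the
      cut-off in F disappears.\<close>
    moreover have "eventually (\<lambda>n. exp (- (Y n * symb a (eps (Y n) *\<^sub>R u))) = F (Y n) u) sequentially"
    proof -
      have "(\<lambda>n. eps (Y n) *\<^sub>R u) \<longlonglongrightarrow> 0" using tendsto_scaleR[OF ey tendsto_const, of u] by simp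
      moreover have "(0 :: real ^ 'n) \<in> box (- (pi *\<^sub>R One)) (pi *\<^sub>R One)" by (simp add: mem_box)
      ultimately have "eventually (\<lambda>n. eps (Y n) *\<^sub>R u \<in> box (- (pi *\<^sub>R One)) (pi *\<^sub>R One)) sequentially"
        using open_box topological_tendstoD by blast
      then show ?thesis
      proof eventually_elim
        case (elim n)
        then have "eps (Y n) *\<^sub>R u \<in> torus" unfolding torus_def using box_subset_cbox by blast
        then show ?case by (simp add: F_def)
      qed
    qed
    ultimately have "(\<lambda>n. F (Y n) u) \<longlonglongrightarrow> exp (- psi u)" by (rule Lim_transform_eventually)
    then show "(\<lambda>n. F (X n) u) \<longlonglongrightarrow> exp (- psi u)"
      unfolding Y_def by (rule LIMSEQ_offset)
  qed
  have em: "(\<lambda>u. exp (- psi u)) \<in> borel_measurable lborel"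
    by (rule borel_measurable_LIMSEQ_real[of _ "\<lambda>n u. F (real n) u"])
       (use filterlim_compose[OF lim filterlim_real_sequentially] in auto)
  have bd: "\<forall>\<^sub>F t in at_top. AE u in lborel. norm (F t u) \<le> w u"
    using eventually_gt_at_top[of 0] by eventually_elim (use Fw in auto)
  have al: "AE u in lborel. ((\<lambda>t. F t u) \<longlongrightarrow> exp (- psi u)) at_top" using lim by simp
  have conv: "((\<lambda>t. \<integral>u. F t u \<partial>lborel) \<longlongrightarrow> (\<integral>u. exp (- psi u) \<partial>lborel)) at_top"
    by (rule integral_dominated_convergence_at_top[OF em Fm wi al bd])
  have ei: "integrable lborel (\<lambda>u. exp (- psi u))"
    by (rule integrable_dominated_convergence_at_top[OF em Fm wi al bd])
  define C where "C = (\<integral>u. exp (- psi u) \<partial>lborel) / (2 * pi) ^ CARD('n)"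
  have "(\<integral>u. exp (- psi u) \<partial>lborel) \<noteq> 0"
    using integral_nonneg_eq_0_iff_AE[OF ei] by (auto simp: eventually_False ae_filter_eq_bot_iff)
  moreover have "(\<integral>u. exp (- psi u) \<partial>lborel) \<ge> 0" by (rule integral_nonneg_AE) simp
  ultimately have "(\<integral>u. exp (- psi u) \<partial>lborel) > 0" by linarith
  then have "C > 0" by (simp add: C_def)
  moreover have "((\<lambda>t. t powr (CARD('n) / \<alpha>) * trans_prob a t 0 0) \<longlongrightarrow> C) at_top"
  proof (rule Lim_transform_eventually)
    show "((\<lambda>t. (\<integral>u. F t u \<partial>lborel) / (2 * pi) ^ CARD('n)) \<longlongrightarrow> C) at_top"
      unfolding C_def by (intro tendsto_divide conv tendsto_const) simp
    show "eventually (\<lambda>t. (\<integral>u. F t u \<partial>lborel) / (2 * pi) ^ CARD('n) = t powr (CARD('n) / \<alpha>) * trans_prob a t 0 0) at_top"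
      using eventually_gt_at_top[of 0]
    proof eventually_elim
      case (elim t)
      have "(\<integral>\<theta>. exp (- (t * symb a \<theta>)) \<partial>Tor) = eps t ^ CARD('n) * (\<integral>u. F t u \<partial>lborel)"
        unfolding F_def by (rule integral_scaled_torus[OF _ e0[OF elim]]) measurable
      moreover have "t powr (CARD('n) / \<alpha>) * eps t ^ CARD('n) = 1"
        using elim e0[OF elim] by (simp add: eps_def powr_realpow[symmetric] powr_powr powr_add[symmetric])
      ultimately show ?case unfolding trans_prob_eq_integral[OF rw]
        by (metis (no_types, lifting) mult.assoc mult_1 times_divide_eq_right)
    qed
  qed
  ultimately show ?thesis by (rule that)
qed

text \<open>By the Fourier formula the return probability is the mean over the torus of a function
  with values in (0, 1].\<close>

lemma trans_prob_bounds:
  assumes "t \<ge> 0"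
  shows "0 < trans_prob a t 0 0" "trans_prob a t 0 0 \<le> 1"
proof -
  note D = rw_intensitiesD[OF rw]
  note [measurable] = symb_measurable[OF D(3)]
  interpret T: finite_measure "Tor :: (real^'n) measure" by (rule finite_measure_Tor)
  have em: "emeasure (Tor :: (real^'n) measure) (space Tor) = ennreal ((2 * pi) ^ CARD('n))"
    by (simp add: emeasure_restrict_space space_restrict_space emeasure_torus)
  then have m: "measure (Tor :: (real^'n) measure) (space Tor) = (2 * pi) ^ CARD('n)"
    by (simp add: measure_def)
  have le: "exp (- (t * symb a \<theta>)) \<le> 1" for \<theta>
    using assms symb_nonneg[of a, OF D(1), where \<theta>=\<theta>] by simp
  have i: "integrable Tor (\<lambda>\<theta>. exp (- (t * symb a \<theta>)))"
    by (intro integrable_Tor_bounded[where B=1]) (use le in auto)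
  have "(\<integral>\<theta>. exp (- (t * symb a \<theta>)) \<partial>Tor) \<le> (\<integral>\<theta>. 1 \<partial>(Tor :: (real^'n) measure))"
    by (intro integral_mono i le) simp
  then show "trans_prob a t 0 0 \<le> 1"
    using m by (simp add: trans_prob_eq_integral[OF rw] space_restrict_space)
  have "(\<integral>\<theta>. exp (- (t * symb a \<theta>)) \<partial>Tor) \<noteq> 0"
  proof
    assume "(\<integral>\<theta>. exp (- (t * symb a \<theta>)) \<partial>Tor) = 0"
    then have "AE \<theta> in (Tor :: (real^'n) measure). False"
      using integral_nonneg_eq_0_iff_AE[OF i] by simp
    then have "emeasure (Tor :: (real^'n) measure) (space Tor) = 0"
      by (simp add: eventually_False ae_filter_eq_bot_iff)
    then show False using em by simp
  qed
  moreover have "(\<integral>\<theta>. exp (- (t * symb a \<theta>)) \<partial>Tor) \<ge> 0" by (rule integral_nonneg_AE) simp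
  ultimately have "(\<integral>\<theta>. exp (- (t * symb a \<theta>)) \<partial>Tor) > 0" by linarith
  then show "0 < trans_prob a t 0 0" by (simp add: trans_prob_eq_integral[OF rw])
qed

lemma trans_prob_measurable: "(\<lambda>t. trans_prob a t 0 0) \<in> borel_measurable borel"
  unfolding trans_prob_def by measurable

end

subsection \<open>Abelian theorems\<close>

text \<open>Replacing t by t / l turns the left side into the integral of k(t) t powr (- s) times (t
  / l) powr s * q (t / l). The last factor is bounded by K and tends to C, so dominated convergence
  applies.\<close>

lemma abelian_power:
  fixes q k :: "real \<Rightarrow> real" and s C :: real
  assumes [measurable]: "q \<in> borel_measurable borel" "k \<in> borel_measurable borel"
    and q0: "\<And>t. t > 0 \<Longrightarrow> \<bar>t powr s * q t\<bar> \<le> K"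
    and lim: "((\<lambda>t. t powr s * q t) \<longlongrightarrow> C) at_top"
    and k: "set_integrable lborel {0<..} (\<lambda>t. k t * t powr - s)"
  shows "((\<lambda>l. l powr (1 - s) * (LINT t:{0<..}|lborel. k (l * t) * q t))
            \<longlongrightarrow> C * (LINT t:{0<..}|lborel. k t * t powr - s)) (at_right 0)"
proof -
  \<comment> \<open>Here y = 1 / l, so that the limit l to 0 becomes one at infinity.\<close>
  define F where "F y t = indicator {0<..} t * (k t * (t powr - s * ((y * t) powr s * q (y * t))))" for y t :: real
  have Fm: "F y \<in> borel_measurable lborel" for y unfolding F_def by measurable
  have w: "integrable lborel (\<lambda>t. K * norm (indicator {0<..} t *\<^sub>R (k t * t powr - s)))"
    using k unfolding set_integrable_def by (intro integrable_mult_right integrable_norm)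
  have fm: "(\<lambda>t. indicator {0<..} t *\<^sub>R (k t * t powr - s) * C) \<in> borel_measurable lborel" by measurable
  have bd: "\<forall>\<^sub>F y in at_top. AE t in lborel. norm (F y t) \<le> K * norm (indicator {0<..} t *\<^sub>R (k t * t powr - s))"
    using eventually_gt_at_top[of 0]
  proof eventually_elim
    case (elim y)
    have "norm (F y t) \<le> K * norm (indicator {0<..} t *\<^sub>R (k t * t powr - s))" for t
    proof (cases "t > 0")
      case True
      then show ?thesis using mult_left_mono[OF q0[of "y * t"], of "\<bar>k t\<bar> * t powr - s"] elim
        by (simp add: F_def abs_mult mult_ac)
    qed (simp add: F_def)
    then show ?case by simp
  qed
  have al: "AE t in lborel. ((\<lambda>y. F y t) \<longlongrightarrow> indicator {0<..} t *\<^sub>R (k t * t powr - s) * C) at_top"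
  proof (rule AE_I2)
    fix t :: real
    show "((\<lambda>y. F y t) \<longlongrightarrow> indicator {0<..} t *\<^sub>R (k t * t powr - s) * C) at_top"
    proof (cases "t > 0")
      case True
      have "filterlim (\<lambda>y. y * t) at_top at_top" using True by real_asymp
      from filterlim_compose[OF lim this]
      show ?thesis using True unfolding F_def
        by (auto simp: mult.assoc intro!: tendsto_intros)
    qed (simp add: F_def)
  qed
  have conv: "((\<lambda>y. \<integral>t. F y t \<partial>lborel) \<longlongrightarrow> (\<integral>t. indicator {0<..} t *\<^sub>R (k t * t powr - s) * C \<partial>lborel)) at_top"
    by (rule integral_dominated_convergence_at_top[OF fm Fm w al bd])
  have "((\<lambda>l. \<integral>t. F (inverse l) t \<partial>lborel) \<longlongrightarrow> (\<integral>t. indicator {0<..} t *\<^sub>R (k t * t powr - s) * C \<partial>lborel)) (at_right 0)"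
    by (rule filterlim_compose[OF conv filterlim_inverse_at_top_right])
  moreover have "eventually (\<lambda>l. (\<integral>t. F (inverse l) t \<partial>lborel) = l powr (1 - s) * (LINT t:{0<..}|lborel. k (l * t) * q t)) (at_right 0)"
    using eventually_at_right_less[of 0]
  proof eventually_elim
    case (elim l)
    have "(LINT t:{0<..}|lborel. k (l * t) * q t) = inverse l * (\<integral>t. indicator {0<..} (inverse l * t) * (k (l * (inverse l * t)) * q (inverse l * t)) \<partial>lborel)"
      using elim lborel_integral_real_affine[of "inverse l" "\<lambda>t. indicator {0<..} t * (k (l * t) * q t)" 0]
      by (simp add: set_lebesgue_integral_def)
    also have "\<dots> = inverse l * (\<integral>t. l powr s * F (inverse l) t \<partial>lborel)"
    proof (rule arg_cong[where f="\<lambda>x. inverse l * x"], rule Bochner_Integration.integral_cong[OF refl])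
      fix t :: real
      show "indicator {0<..} (inverse l * t) * (k (l * (inverse l * t)) * q (inverse l * t)) = l powr s * F (inverse l) t"
      proof (cases "t > 0")
        case True
        have "l powr s * (t powr - s * (inverse l * t) powr s) = 1"
          using True elim by (simp add: powr_divide powr_minus field_simps)
        then have "l powr s * F (inverse l) t = k t * q (inverse l * t)"
          using True unfolding F_def by (simp add: algebra_simps)
        moreover have eq: "l * (inverse l * t) = t" using elim by simp
        ultimately show ?thesis unfolding eq using True elim by simp
      next
        case False
        then show ?thesis using elim by (auto simp: F_def indicator_def zero_less_mult_iff)
      qed
    qed
    finally show ?case using elim by (simp add: powr_diff field_simps)
  qed
  ultimately have "((\<lambda>l. l powr (1 - s) * (LINT t:{0<..}|lborel. k (l * t) * q t))
     \<longlongrightarrow> (\<integral>t. indicator {0<..} t *\<^sub>R (k t * t powr - s) * C \<partial>lborel)) (at_right 0)"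
    by (rule Lim_transform_eventually)
  then show ?thesis by (simp add: set_lebesgue_integral_def mult.commute)
qed

lemma set_integrable_lborel_of_has_integral:
  fixes f :: "real \<Rightarrow> real"
  assumes "f \<in> borel_measurable borel" "S \<in> sets borel" "\<And>x. x \<in> S \<Longrightarrow> f x \<ge> 0" "(f has_integral I) S"
  shows "set_integrable lborel S f"
proof -
  have "f absolutely_integrable_on S"
    using assms by (intro nonnegative_absolutely_integrable_1) auto
  then show ?thesis
    using assms by (simp add: set_integrable_def integrable_completion)
qed

lemma set_integrable_powr_bounds:
  fixes f :: "real \<Rightarrow> real"
  assumes [measurable]: "f \<in> borel_measurable borel"
    and p: "p > - 1" "\<And>t. 0 < t \<Longrightarrow> t \<le> 1 \<Longrightarrow> \<bar>f t\<bar> \<le> A * t powr p"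
    and r: "r > 1" "\<And>t. t > 1 \<Longrightarrow> \<bar>f t\<bar> \<le> B * t powr - r"
  shows "set_integrable lborel {0<..} f"
  unfolding set_integrable_def
proof (rule Bochner_Integration.integrable_bound)
  have 1: "set_integrable lborel {0..1} (\<lambda>t. t powr p)"
    by (rule set_integrable_lborel_of_has_integral[OF _ _ _ has_integral_powr_from_0[OF p(1)]]) auto
  have 2: "set_integrable lborel {1..} (\<lambda>t. t powr - r)"
    by (rule set_integrable_lborel_of_has_integral[OF _ _ _ has_integral_powr_to_inf]) (use r in auto)
  show "integrable lborel (\<lambda>t. \<bar>A\<bar> * (indicator {0..1} t *\<^sub>R t powr p) + \<bar>B\<bar> * (indicator {1..} t *\<^sub>R t powr - r))"
    using 1 2 unfolding set_integrable_def
    by (intro Bochner_Integration.integrable_add integrable_mult_right)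
  show "AE t in lborel. norm (indicator {0<..} t *\<^sub>R f t)
    \<le> norm (\<bar>A\<bar> * (indicator {0..1} t *\<^sub>R t powr p) + \<bar>B\<bar> * (indicator {1..} t *\<^sub>R t powr - r))"
  proof (rule AE_I2)
    fix t :: real
    consider "t \<le> 0" | "0 < t" "t \<le> 1" | "t > 1" by linarith
    then show "norm (indicator {0<..} t *\<^sub>R f t)
      \<le> norm (\<bar>A\<bar> * (indicator {0..1} t *\<^sub>R t powr p) + \<bar>B\<bar> * (indicator {1..} t *\<^sub>R t powr - r))"
    proof cases
      case 2
      have "\<bar>f t\<bar> \<le> \<bar>A\<bar> * t powr p"
        using p(2)[OF 2] by (rule order.trans) (intro mult_right_mono, auto)
      also have "\<dots> \<le> \<bar>A\<bar> * t powr p + \<bar>B\<bar> * (indicator {1..} t * t powr - r)" by simp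
      finally show ?thesis using 2 by simp
    next
      case 3
      have "\<bar>f t\<bar> \<le> \<bar>B\<bar> * t powr - r"
        using r(2)[OF 3] by (rule order.trans) (intro mult_right_mono, auto)
      then show ?thesis using 3 by simp
    qed auto
  qed
qed measurable

lemma integrable_exp_minus_abs: "integrable lborel (\<lambda>v :: real. exp (- \<bar>v\<bar>))"
proof -
  have "set_integrable lborel {0..} (\<lambda>v :: real. exp (- v))"
    using has_integral_exp_minus_to_infinity[of 1 0]
    by (intro set_integrable_lborel_of_has_integral) auto
  then have i: "integrable lborel (\<lambda>v :: real. indicator {0..} v * exp (- v))" by (simp add: set_integrable_def)
  from Bochner_Integration.integrable_add[OF i lborel_integrable_real_affine[OF i, of "-1" 0]]
  have "integrable lborel (\<lambda>v :: real. indicator {0..} v * exp (- v) + indicator {0..} (- v) * exp v)" by simp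
  then show ?thesis
    by (rule Bochner_Integration.integrable_bound) (auto simp: indicator_def)
qed

text \<open>The substitution \<open>t = (1 / l) powr v\<close> turns \<open>dt / t\<close> into \<open>- ln l\<close> times \<open>dv\<close>; in the limit only
  \<open>0 < v < 1\<close> contributes.\<close>

lemma abelian_log:
  fixes R k :: "real \<Rightarrow> real"
  assumes [measurable]: "R \<in> borel_measurable borel" "k \<in> borel_measurable borel"
    and R0: "\<And>t. 0 < t \<Longrightarrow> t \<le> 1 \<Longrightarrow> \<bar>R t\<bar> \<le> t" and RK: "\<And>t. 0 < t \<Longrightarrow> \<bar>R t\<bar> \<le> K"
    and R_lim: "(R \<longlongrightarrow> C) at_top"
    and k1: "\<And>x. 0 < x \<Longrightarrow> \<bar>k x\<bar> \<le> 1" and kx: "\<And>x. 0 < x \<Longrightarrow> \<bar>k x\<bar> \<le> 1 / x"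
    and k_lim: "(k \<longlongrightarrow> 1) (at_right 0)"
  shows "((\<lambda>l. (LINT t:{0<..}|lborel. k (l * t) * R t / t) / (- ln l)) \<longlongrightarrow> C) (at_right 0)"
proof -
  have K0: "K \<ge> 0" using RK[of 1] by simp
  \<comment> \<open>With L = - ln l and t = exp (L v), the product l t becomes exp (L (v -
    1)).\<close>
  define F where "F L v = k (exp (L * (v - 1))) * R (exp (L * v))" for L v :: real
  define f where "f v = C * indicator {0<..<1} v" for v :: real
  \<comment> \<open>For v <= 0 the decay comes from |R t| <= t, for v > 1 from |k x| <= 1 / x; in
    between boundedness suffices, and exp 1 compensates the shift by 1.\<close>
  define w where "w v = (K + 1) * exp 1 * exp (- \<bar>v\<bar>)" for v :: real
  have Fm [measurable]: "F L \<in> borel_measurable borel" for L unfolding F_def by measurable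
  have wi: "integrable lborel w" unfolding w_def by (intro integrable_mult_right integrable_exp_minus_abs)
  have Fw: "\<bar>F L v\<bar> \<le> w v" if "L \<ge> 1" for L v
  proof -
    consider "v \<le> 0" | "0 < v" "v \<le> 1" | "v > 1" by linarith
    then show ?thesis
    proof cases
      case 1
      have "\<bar>F L v\<bar> \<le> 1 * exp (L * v)"
        unfolding F_def abs_mult using 1 that mult_nonneg_nonpos[of L v] by (intro mult_mono k1 R0) auto
      also have "exp (L * v) \<le> exp v" using mult_right_mono_neg[OF that 1] by simp
      also have "1 * exp v \<le> ((K + 1) * exp 1) * exp v"
        using K0 mult_mono[of 1 "K + 1" 1 "exp 1 :: real"] by (intro mult_right_mono) simp_all
      finally show ?thesis using 1 by (simp add: w_def)
    next
      case 2
      have "\<bar>F L v\<bar> \<le> 1 * K"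
        unfolding F_def abs_mult by (intro mult_mono k1 RK) auto
      also have "\<dots> \<le> (K + 1) * exp (1 - v)"
        using K0 2 mult_mono[of 1 "exp (1 - v)" K "K + 1"] by (simp add: mult.commute)
      finally show ?thesis using 2 by (simp add: w_def exp_diff exp_minus field_simps)
    next
      case 3
      have "\<bar>F L v\<bar> \<le> (1 / exp (L * (v - 1))) * K"
        unfolding F_def abs_mult by (intro mult_mono kx RK) auto
      also have "1 / exp (L * (v - 1)) = exp (- (L * (v - 1)))" by (simp add: exp_minus inverse_eq_divide del: minus_mult_right mult_minus_right minus_diff_eq)
      also have "exp (- (L * (v - 1))) \<le> exp (1 - v)"
        unfolding exp_le_cancel_iff using mult_right_mono[OF that, of "v - 1", simplified] 3 by linarith
      also have "exp (1 - v) * K \<le> (K + 1) * exp (1 - v)" by (simp add: algebra_simps)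
      finally show ?thesis using 3 K0 by (simp add: w_def exp_diff exp_minus field_simps mult_right_mono)
    qed
  qed
  \<comment> \<open>At v = 0 and v = 1 the values R 1 and k 1 would enter the limit; these two
    points form a null set.\<close>
  have lim: "((\<lambda>L. F L v) \<longlongrightarrow> f v) at_top" if v: "v \<noteq> 0" "v \<noteq> 1" for v
  proof -
    consider "v < 0" | "0 < v" "v < 1" | "v > 1" using v by linarith
    then show ?thesis
    proof cases
      case 1
      have "((\<lambda>L. F L v) \<longlongrightarrow> 0) at_top"
      proof (rule Lim_null_comparison)
        show "((\<lambda>L. exp (L * v)) \<longlongrightarrow> 0) at_top" using 1 by real_asymp
        have "\<bar>F L v\<bar> \<le> 1 * exp (L * v)" if "L \<ge> 1" for L
          unfolding F_def abs_mult using 1 that mult_nonneg_nonpos[of L v] by (intro mult_mono k1 R0) auto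
        then show "\<forall>\<^sub>F L in at_top. norm (F L v) \<le> exp (L * v)"
          by (intro eventually_at_top_linorderI[of 1]) simp
      qed
      then show ?thesis using 1 by (simp add: f_def)
    next
      case 2
      have a: "filterlim (\<lambda>L. exp (L * (v - 1))) (at_right 0) at_top" using 2 by real_asymp
      have b: "filterlim (\<lambda>L. exp (L * v)) at_top at_top" using 2 by real_asymp
      have "((\<lambda>L. F L v) \<longlongrightarrow> 1 * C) at_top"
        unfolding F_def by (intro tendsto_mult filterlim_compose[OF k_lim a] filterlim_compose[OF R_lim b])
      then show ?thesis using 2 by (simp add: f_def)
    next
      case 3
      have "((\<lambda>L. F L v) \<longlongrightarrow> 0) at_top"
      proof (rule Lim_null_comparison)
        show "((\<lambda>L. (1 / exp (L * (v - 1))) * K) \<longlongrightarrow> 0) at_top" using 3 by real_asymp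
        have "\<bar>F L v\<bar> \<le> (1 / exp (L * (v - 1))) * K" for L
          unfolding F_def abs_mult by (intro mult_mono kx RK) auto
        then show "\<forall>\<^sub>F L in at_top. norm (F L v) \<le> (1 / exp (L * (v - 1))) * K" by simp
      qed
      then show ?thesis using 3 by (simp add: f_def)
    qed
  qed
  have fm: "f \<in> borel_measurable lborel" and Fm': "F L \<in> borel_measurable lborel" for L
    unfolding f_def by measurable
  have al: "AE v in lborel. ((\<lambda>L. F L v) \<longlongrightarrow> f v) at_top"
    using AE_lborel_singleton[of 0] AE_lborel_singleton[of 1] by eventually_elim (rule lim)
  have bd: "\<forall>\<^sub>F L in at_top. AE v in lborel. norm (F L v) \<le> w v"
    using eventually_ge_at_top[of 1] by eventually_elim (use Fw in auto)
  have "((\<lambda>L. \<integral>v. F L v \<partial>lborel) \<longlongrightarrow> (\<integral>v. f v \<partial>lborel)) at_top"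
    by (rule integral_dominated_convergence_at_top[OF fm Fm' wi al bd])
  then have conv: "((\<lambda>L. \<integral>v. F L v \<partial>lborel) \<longlongrightarrow> C) at_top" by (simp add: f_def)
  have "filterlim (\<lambda>l :: real. - ln l) at_top (at_right 0)" by real_asymp
  from filterlim_compose[OF conv this]
  have "((\<lambda>l. \<integral>v. F (- ln l) v \<partial>lborel) \<longlongrightarrow> C) (at_right 0)" .
  moreover have "eventually (\<lambda>l. (\<integral>v. F (- ln l) v \<partial>lborel) = (LINT t:{0<..}|lborel. k (l * t) * R t / t) / (- ln l)) (at_right 0)"
    \<comment> \<open>The bound l < exp (- 1) gives L >= 1.\<close>
    using eventually_at_right_real[of 0 "exp (-1)", OF exp_gt_zero]
  proof (eventually_elim)
    case (elim l)
    define L where "L = - ln l"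
    have L: "L \<ge> 1" and lL: "l = exp (- L)"
      using elim ln_less_cancel_iff[of l "exp (-1)"] by (auto simp: L_def)
    define h where "h t = k (l * t) * R t / t" for t
    have hint: "set_integrable lborel {0<..} h"
    proof (rule set_integrable_powr_bounds[where p=0 and A=1 and r=2 and B="K / l"])
      show "h \<in> borel_measurable borel" unfolding h_def by measurable
      fix t :: real
      assume t: "0 < t" "t \<le> 1"
      have "\<bar>k (l * t)\<bar> * \<bar>R t\<bar> \<le> 1 * t" using t elim by (intro mult_mono k1 R0) auto
      then show "\<bar>h t\<bar> \<le> 1 * t powr 0" using t by (simp add: h_def abs_mult field_simps)
    next
      fix t :: real assume t: "t > 1"
      have "\<bar>k (l * t)\<bar> * \<bar>R t\<bar> \<le> (1 / (l * t)) * K" using t elim by (intro mult_mono kx RK) auto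
      then have "\<bar>k (l * t)\<bar> * \<bar>R t\<bar> / t \<le> (1 / (l * t)) * K / t" using t by (intro divide_right_mono) auto
      then show "\<bar>h t\<bar> \<le> K / l * t powr - 2"
        using t elim by (simp add: h_def abs_mult powr_minus powr_numeral power2_eq_square field_simps)
    qed auto
    have im: "(\<lambda>v. exp (L * v)) ` UNIV = {0<..}"
    proof (intro equalityI subsetI)
      fix t :: real assume "t \<in> {0<..}"
      then have "t = exp (L * (ln t / L))" using L by simp
      then show "t \<in> (\<lambda>v. exp (L * v)) ` UNIV" by blast
    qed auto
    \<comment> \<open>The change of variables is carried out for the completed measure, hence the
      passage from \<open>lborel\<close> to \<open>lebesgue\<close> and back.\<close>
    have "set_integrable lebesgue {0<..} h"
      using hint unfolding set_integrable_def by (subst integrable_completion) auto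
    moreover have "((\<lambda>v. exp (L * v)) has_field_derivative L * exp (L * v)) (at v within UNIV)" for v
      by (auto intro!: derivative_eq_intros)
    moreover have "inj (\<lambda>v. exp (L * v))" using L by (auto simp: inj_def)
    ultimately have cv: "(\<lambda>v. \<bar>L * exp (L * v)\<bar> * h (exp (L * v))) absolutely_integrable_on UNIV \<and>
       integral UNIV (\<lambda>v. \<bar>L * exp (L * v)\<bar> * h (exp (L * v))) = integral {0<..} h"
      using has_absolute_integral_change_of_variables_1'[of UNIV "\<lambda>v. exp (L * v)" "\<lambda>v. L * exp (L * v)" h "integral {0<..} h"]
      by (simp add: im)
    have hF: "\<bar>L * exp (L * v)\<bar> * h (exp (L * v)) = L * F L v" for v
    proof -
      have "l * exp (L * v) = exp (L * (v - 1))" by (simp add: lL exp_add[symmetric] algebra_simps)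
      then show ?thesis using L by (simp add: h_def F_def abs_mult)
    qed
    have "integrable lebesgue (\<lambda>v. L * F L v)"
      using cv unfolding hF by (simp add: set_integrable_def)
    then have "integrable lborel (\<lambda>v. L * F L v)" by (subst (asm) integrable_completion) auto
    then have "(\<integral>v. L * F L v \<partial>lborel) = integral UNIV (\<lambda>v. L * F L v)" by (rule integral_lborel[symmetric])
    also have "\<dots> = (LINT t:{0<..}|lborel. h t)"
      using cv set_borel_integral_eq_integral(2)[OF hint] by (simp add: hF)
    finally show ?case using L by (simp add: L_def[symmetric] h_def field_simps)
  qed
  ultimately show ?thesis by (rule Lim_transform_eventually)
qed

lemma asymp_equiv_powr_at_right_0:
  fixes f :: "real \<Rightarrow> real"
  assumes "((\<lambda>l. l powr - r * f l) \<longlongrightarrow> c) (at_right 0)" "c \<noteq> 0"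
  shows "f \<sim>[at_right 0] (\<lambda>l. c * l powr r)"
proof (rule asymp_equivI')
  have "((\<lambda>l. (l powr - r * f l) / c) \<longlongrightarrow> c / c) (at_right 0)"
    using assms by (intro tendsto_intros)
  then have "((\<lambda>l. (l powr - r * f l) / c) \<longlongrightarrow> 1) (at_right 0)" using assms(2) by simp
  then show "((\<lambda>l. f l / (c * l powr r)) \<longlongrightarrow> 1) (at_right 0)"
    by (simp add: powr_minus field_simps)
qed

lemma one_minus_exp_minus_bounds:
  fixes x :: real assumes "x \<ge> 0"
  shows "0 \<le> 1 - exp (- x)" "1 - exp (- x) \<le> 1" "1 - exp (- x) \<le> x"
  using assms exp_ge_add_one_self[of "- x"] by auto

lemma exp_minus_le_inverse:
  fixes x :: real assumes "x > 0" shows "exp (- x) \<le> 1 / x"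
proof -
  have "x \<le> exp x" using exp_ge_add_one_self[of x] by linarith
  then show ?thesis using assms by (simp add: exp_minus field_simps)
qed

lemma set_integral_pos:
  fixes f :: "real \<Rightarrow> real"
  assumes "set_integrable lborel {0<..} f" "\<And>t. t > 0 \<Longrightarrow> f t > 0"
  shows "(LINT t:{0<..}|lborel. f t) > 0"
proof -
  have nn: "AE t in lborel. 0 \<le> indicator {0<..} t *\<^sub>R f t"
    using assms(2) by (intro AE_I2) (auto simp: indicator_def less_imp_le)
  have "(LINT t:{0<..}|lborel. f t) \<noteq> 0"
  proof
    assume "(LINT t:{0<..}|lborel. f t) = 0"
    then have "AE t in lborel. indicator {0<..} t *\<^sub>R f t = 0"
      using integral_nonneg_eq_0_iff_AE[OF assms(1)[unfolded set_integrable_def] nn]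
      by (simp add: set_lebesgue_integral_def)
    then have "AE t in lborel. t \<notin> {0::real<..}"
    proof eventually_elim
      case (elim t)
      then show ?case using assms(2)[of t] by (auto simp: indicator_def)
    qed
    then have "{0::real<..} \<in> null_sets lborel"
      by (subst (asm) AE_iff_null_sets[symmetric]) auto
    moreover have "emeasure lborel {0<..<1::real} \<le> emeasure lborel {0::real<..}" by (rule emeasure_mono) auto
    ultimately show False by (simp add: null_sets_def)
  qed
  moreover have "(LINT t:{0<..}|lborel. f t) \<ge> 0"
    unfolding set_lebesgue_integral_def by (rule integral_nonneg_AE[OF nn])
  ultimately show ?thesis by linarith
qed

lemma AE_indicator_Ioi_Ici: "AE t in lborel. indicator {0::real..} t *\<^sub>R f t = indicator {0<..} t *\<^sub>R (f t :: real)"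
  using AE_lborel_singleton[of 0] by eventually_elim (auto simp: indicator_def)

section \<open>Laplace transforms of functions with a power tail, by the size of s\<close>

locale power_tail =
  fixes q :: "real \<Rightarrow> real" and s C :: real
  assumes q_measurable [measurable]: "q \<in> borel_measurable borel"
    and q_pos: "\<And>t. t \<ge> 0 \<Longrightarrow> q t > 0" and q_le_1: "\<And>t. t \<ge> 0 \<Longrightarrow> q t \<le> 1"
    and s_pos: "s > 0" and C_pos: "C > 0"
    and tail: "((\<lambda>t. t powr s * q t) \<longlongrightarrow> C) at_top"
begin

definition laplace :: "real \<Rightarrow> real" where
  "laplace l = (LINT t:{0..}|lborel. exp (- l * t) * q t)"

lemma laplace_eq: "laplace l = (LINT t:{0<..}|lborel. exp (- (l * t)) * q t)"
  unfolding laplace_def set_lebesgue_integral_def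
  by (rule integral_cong_AE) (use AE_indicator_Ioi_Ici[of "\<lambda>t. exp (- (l * t)) * q t"] in auto)

text \<open>Beyond T the limit bounds the product; before T the bound \<open>q \<le> 1\<close> does,
  because s > 0.\<close>

lemma q_bound:
  obtains K where "\<And>t. t > 0 \<Longrightarrow> \<bar>t powr s * q t\<bar> \<le> K"
proof -
  obtain T where T: "\<And>t. t \<ge> T \<Longrightarrow> t powr s * q t < C + 1"
    using order_tendstoD(2)[OF tail, of "C + 1"] by (auto simp: eventually_at_top_linorder)
  show ?thesis
  proof (rule that)
    fix t :: real assume t: "t > 0"
    have "t powr s * q t \<le> (C + 1) + \<bar>T\<bar> powr s"
    proof (cases "t \<ge> T")
      case True
      then show ?thesis using T[of t] by (smt (verit) powr_ge_zero)
    next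
      case False
      have "t powr s * q t \<le> \<bar>T\<bar> powr s * 1"
        using False t s_pos q_le_1[of t] q_pos[of t] by (intro mult_mono powr_mono2) auto
      then show ?thesis using C_pos by simp
    qed
    then show "\<bar>t powr s * q t\<bar> \<le> (C + 1) + \<bar>T\<bar> powr s"
      using q_pos[of t] t by simp
  qed
qed

lemma set_integrable_mult_q:
  assumes [measurable]: "g \<in> borel_measurable borel"
    and p: "p > - 1" "\<And>t. 0 < t \<Longrightarrow> t \<le> 1 \<Longrightarrow> \<bar>g t\<bar> \<le> A * t powr p"
    and r: "s - r > 1" "\<And>t. t > 1 \<Longrightarrow> \<bar>g t\<bar> \<le> B * t powr r"
  shows "set_integrable lborel {0<..} (\<lambda>t. g t * q t)"
proof -
  obtain K where K: "\<And>t. t > 0 \<Longrightarrow> \<bar>t powr s * q t\<bar> \<le> K" by (rule q_bound) blast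
  show ?thesis
  proof (rule set_integrable_powr_bounds[OF _ p(1) _ r(1), where A=A and B="B * K"])
    fix t :: real
    assume t: "0 < t" "t \<le> 1"
    have "\<bar>g t * q t\<bar> \<le> \<bar>g t\<bar> * 1"
      unfolding abs_mult using q_pos[of t] q_le_1[of t] t by (intro mult_left_mono) auto
    also have "\<dots> \<le> A * t powr p" using p(2)[OF t] by simp
    finally show "\<bar>g t * q t\<bar> \<le> A * t powr p" .
  next
    fix t :: real
    assume t: "t > 1"
    have "\<bar>g t * q t\<bar> * t powr s = \<bar>g t\<bar> * \<bar>t powr s * q t\<bar>" by (simp add: abs_mult)
    also have "\<dots> \<le> (B * t powr r) * K"
      using r(2)[OF t] K[of t] t by (intro mult_mono) auto
    finally have "\<bar>g t * q t\<bar> \<le> (B * t powr r) * K / t powr s" using t by (simp add: field_simps)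
    also have "\<dots> = B * K * t powr - (s - r)" using t by (simp add: powr_diff powr_minus field_simps)
    finally show "\<bar>g t * q t\<bar> \<le> B * K * t powr - (s - r)" .
  qed measurable
qed

lemma set_integrable_exp_q:
  assumes "l > 0" shows "set_integrable lborel {0<..} (\<lambda>t. exp (- (l * t)) * q t)"
proof -
  have le: "\<bar>exp (- (l * t)) * q t\<bar> \<le> 1 * t powr 0" "\<bar>exp (- (l * t)) * q t\<bar> \<le> 2 / l\<^sup>2 * t powr - 2"
    if t: "0 < t" for t
  proof -
  have "exp (- (l * t)) * q t \<le> exp (- (l * t)) * 1"
    using q_le_1[of t] t by (intro mult_left_mono) auto
  then have le: "\<bar>exp (- (l * t)) * q t\<bar> \<le> exp (- (l * t))" using q_pos[of t] t by simp
  show "\<bar>exp (- (l * t)) * q t\<bar> \<le> 1 * t powr 0"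
    using t assms by (intro order.trans[OF le]) simp
  \<comment> \<open>The quadratic term of the exponential already gives a tail integrable at
    infinity.\<close>
  have "1 + l * t + (l * t)\<^sup>2 / 2 \<le> exp (l * t)" using assms t by (intro exp_lower_Taylor_quadratic) simp
  then have "(l * t)\<^sup>2 / 2 \<le> exp (l * t)" using assms t by (smt (verit) mult_pos_pos)
  then have "exp (- (l * t)) \<le> 2 / l\<^sup>2 * t powr - 2"
    using t assms by (simp add: exp_minus powr_minus powr_numeral field_simps power_mult_distrib)
  with le show "\<bar>exp (- (l * t)) * q t\<bar> \<le> 2 / l\<^sup>2 * t powr - 2" by linarith
  qed
  show ?thesis
    by (rule set_integrable_powr_bounds[where p=0 and A=1 and r=2 and B="2 / l\<^sup>2"]) (use le in auto)
qed

text \<open>Kernel exp (- x): the singularity t powr (- s) is integrable at 0 since s < 1. The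
  constant is C times Gamma (1 - s).\<close>

lemma laplace_asymp_s_less_1:
  assumes "s < 1"
  shows "\<exists>\<gamma>>0. laplace \<sim>[at_right 0] (\<lambda>l. \<gamma> * l powr (s - 1))"
proof -
  obtain K where K: "\<And>t. t > 0 \<Longrightarrow> \<bar>t powr s * q t\<bar> \<le> K" by (rule q_bound) blast
  have i: "set_integrable lborel {0<..} (\<lambda>t. exp (- t) * t powr - s)"
  proof -
    have *: "\<bar>exp (- t) * t powr - s\<bar> \<le> 1 * t powr - s" "\<bar>exp (- t) * t powr - s\<bar> \<le> 1 * t powr - (1 + s)"
      if t: "0 < t" for t :: real
    proof -
    show "\<bar>exp (- t) * t powr - s\<bar> \<le> 1 * t powr - s" using t by simp
    have "exp (- t) * t powr - s \<le> (1 / t) * t powr - s"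
      using t by (intro mult_right_mono exp_minus_le_inverse) auto
    also have "\<dots> = t powr - (1 + s)" using t by (simp add: powr_minus powr_add field_simps del: minus_add_distrib)
    finally show "\<bar>exp (- t) * t powr - s\<bar> \<le> 1 * t powr - (1 + s)" by simp
    qed
    show ?thesis
      by (rule set_integrable_powr_bounds[OF _ _ *(1) _ *(2)]) (use assms s_pos in auto)
  qed
  define \<gamma> where "\<gamma> = C * (LINT t:{0<..}|lborel. exp (- t) * t powr - s)"
  have "\<gamma> > 0" unfolding \<gamma>_def by (intro mult_pos_pos C_pos set_integral_pos i) auto
  moreover have "((\<lambda>l. l powr (1 - s) * laplace l) \<longlongrightarrow> \<gamma>) (at_right 0)"
    unfolding \<gamma>_def laplace_eq by (rule abelian_power[OF _ _ K tail i]) auto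
  then have "laplace \<sim>[at_right 0] (\<lambda>l. \<gamma> * l powr (s - 1))"
    using \<open>\<gamma> > 0\<close> by (intro asymp_equiv_powr_at_right_0) auto
  ultimately show ?thesis by blast
qed

text \<open>exp (- t) / t just fails to be integrable at 0, so \<open>abelian_log\<close> takes over
  with R(t) = t q(t); the constant is C itself.\<close>

lemma laplace_asymp_s_eq_1:
  assumes "s = 1"
  shows "\<exists>\<gamma>>0. laplace \<sim>[at_right 0] (\<lambda>l. - \<gamma> * ln l)"
proof (intro exI conjI asymp_equivI')
  obtain K where K: "\<And>t. t > 0 \<Longrightarrow> \<bar>t powr s * q t\<bar> \<le> K" by (rule q_bound) blast
  show "C > 0" by (rule C_pos)
  have "((\<lambda>l. (LINT t:{0<..}|lborel. exp (- (l * t)) * (t powr s * q t) / t) / (- ln l)) \<longlongrightarrow> C) (at_right 0)"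
  proof (rule abelian_log[OF _ _ _ K tail])
    show "((\<lambda>x :: real. exp (- x)) \<longlongrightarrow> 1) (at_right 0)" by real_asymp
    show "\<bar>t powr s * q t\<bar> \<le> t" if "0 < t" for t
      using that q_le_1[of t] q_pos[of t] mult_left_mono[of "q t" 1 t] by (simp add: assms)
  qed (auto intro: exp_minus_le_inverse)
  moreover have "(LINT t:{0<..}|lborel. exp (- (l * t)) * (t powr s * q t) / t) = laplace l" for l
    unfolding laplace_eq by (intro set_lebesgue_integral_cong) (auto simp: assms)
  ultimately have "((\<lambda>l. laplace l / (- ln l) / C) \<longlongrightarrow> C / C) (at_right 0)"
    using C_pos by (intro tendsto_divide tendsto_const) auto
  then show "((\<lambda>l. laplace l / (- C * ln l)) \<longlongrightarrow> 1) (at_right 0)"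
    using C_pos by (simp add: mult.commute)
qed

lemma set_integrable_q:
  assumes "s > 1" shows "set_integrable lborel {0<..} q"
  using set_integrable_mult_q[of "\<lambda>_. 1" 0 1 0 1] assms by simp

lemma set_integrable_q_Ici:
  assumes "s > 1" shows "set_integrable lborel {0..} q"
  using set_integrable_q[OF assms] integrable_cong_AE[OF _ _ AE_indicator_Ioi_Ici[of q]]
  unfolding set_integrable_def by simp

lemma laplace_diff:
  assumes "s > 1" "l > 0"
  shows "laplace l - laplace 0 = - (LINT t:{0<..}|lborel. (1 - exp (- (l * t))) * q t)"
proof -
  have "(LINT t:{0<..}|lborel. q t - exp (- (l * t)) * q t) = laplace 0 - laplace l"
    unfolding laplace_eq using set_integrable_q[OF assms(1)] set_integrable_exp_q[OF assms(2)]
    by (subst set_integral_diff) auto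
  then show ?thesis by (simp add: left_diff_distrib)
qed

lemma laplace_diff_asympI:
  assumes "s > 1" "c > 0" and g: "\<And>l. 0 < l \<Longrightarrow> l < 1 \<Longrightarrow> g l > 0"
    and lim: "((\<lambda>l. (LINT t:{0<..}|lborel. (1 - exp (- (l * t))) * q t) / g l) \<longlongrightarrow> c) (at_right 0)"
  shows "(\<lambda>l. laplace l - laplace 0) \<sim>[at_right 0] (\<lambda>l. - c * g l)"
proof (rule asymp_equivI', rule Lim_transform_eventually)
  show "((\<lambda>l. (LINT t:{0<..}|lborel. (1 - exp (- (l * t))) * q t) / g l / c) \<longlongrightarrow> 1) (at_right 0)"
    using tendsto_divide[OF lim tendsto_const[of c]] assms(2) by simp
  show "\<forall>\<^sub>F l in at_right 0. (LINT t:{0<..}|lborel. (1 - exp (- (l * t))) * q t) / g l / c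
     = (laplace l - laplace 0) / (- c * g l)"
    using eventually_at_right_less[of 0]
    by eventually_elim (simp add: laplace_diff[OF assms(1)] mult.commute)
qed

text \<open>Kernel 1 - exp (- x): its linear decay at 0 needs s < 2, its boundedness at infinity
  needs s > 1. The constant is C times Gamma (2 - s) / (s - 1).\<close>

lemma laplace_asymp_s_between_1_2:
  assumes "1 < s" "s < 2"
  shows "\<exists>\<gamma>>0. (\<lambda>l. laplace l - laplace 0) \<sim>[at_right 0] (\<lambda>l. - \<gamma> * l powr (s - 1))"
proof -
  obtain K where K: "\<And>t. t > 0 \<Longrightarrow> \<bar>t powr s * q t\<bar> \<le> K" by (rule q_bound) blast
  have i: "set_integrable lborel {0<..} (\<lambda>t. (1 - exp (- t)) * t powr - s)"
  proof -
    have *: "\<bar>(1 - exp (- t)) * t powr - s\<bar> \<le> 1 * t powr (1 - s)" "\<bar>(1 - exp (- t)) * t powr - s\<bar> \<le> 1 * t powr - s"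
      if t: "0 < t" for t :: real
    proof -
    have "(1 - exp (- t)) * t powr - s \<le> t * t powr - s"
      using t one_minus_exp_minus_bounds[of t] by (intro mult_right_mono) auto
    also have "\<dots> = t powr (1 - s)" using t by (simp add: powr_diff powr_minus field_simps)
    finally show "\<bar>(1 - exp (- t)) * t powr - s\<bar> \<le> 1 * t powr (1 - s)" using t by simp
    show "\<bar>(1 - exp (- t)) * t powr - s\<bar> \<le> 1 * t powr - s"
      using t by (simp add: abs_mult mult_left_le_one_le)
    qed
    show ?thesis
      by (rule set_integrable_powr_bounds[OF _ _ *(1) _ *(2)]) (use assms in auto)
  qed
  define \<gamma> where "\<gamma> = C * (LINT t:{0<..}|lborel. (1 - exp (- t)) * t powr - s)"
  have "\<gamma> > 0" unfolding \<gamma>_def by (intro mult_pos_pos C_pos set_integral_pos i) auto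
  moreover have "((\<lambda>l. l powr (1 - s) * (LINT t:{0<..}|lborel. (1 - exp (- (l * t))) * q t)) \<longlongrightarrow> \<gamma>) (at_right 0)"
    unfolding \<gamma>_def by (rule abelian_power[OF _ _ K tail i]) auto
  then have "((\<lambda>l. (LINT t:{0<..}|lborel. (1 - exp (- (l * t))) * q t) / l powr (s - 1)) \<longlongrightarrow> \<gamma>) (at_right 0)"
    using powr_minus[of _ "s - 1"] by (simp add: field_simps)
  ultimately show ?thesis using laplace_diff_asympI[OF assms(1), of \<gamma> "\<lambda>l. l powr (s - 1)"] by auto
qed

lemma laplace_asymp_s_eq_2:
  assumes "s = 2"
  shows "\<exists>\<gamma>>0. (\<lambda>l. laplace l - laplace 0) \<sim>[at_right 0] (\<lambda>l. \<gamma> * l * ln l)"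
proof (intro exI conjI)
  obtain K where K: "\<And>t. t > 0 \<Longrightarrow> \<bar>t powr s * q t\<bar> \<le> K" by (rule q_bound) blast
  show "C > 0" by (rule C_pos)
  \<comment> \<open>Dividing 1 - exp (- l t) by l leaves t k(l t), so R(t) = t powr 2 * q(t) brings
    the integral into the form required by \<open>abelian_log\<close>.\<close>
  define k where "k x = (1 - exp (- x)) / x" for x :: real
  have "((\<lambda>l. (LINT t:{0<..}|lborel. k (l * t) * (t powr s * q t) / t) / (- ln l)) \<longlongrightarrow> C) (at_right 0)"
  proof (rule abelian_log[OF _ _ _ K tail])
    show "(k \<longlongrightarrow> 1) (at_right 0)" unfolding k_def by real_asymp
    show "\<bar>t powr s * q t\<bar> \<le> t" if "0 < t" "t \<le> 1" for t
    proof -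
      have "t powr 2 * q t \<le> t\<^sup>2 * 1"
        using that q_le_1[of t] by (simp add: powr_numeral mult_left_le)
      also have "\<dots> \<le> t" using that by (simp add: power2_eq_square mult_left_le)
      finally show ?thesis using that q_pos[of t] by (simp add: assms)
    qed
    show "\<bar>k x\<bar> \<le> 1" "\<bar>k x\<bar> \<le> 1 / x" if "0 < x" for x
      using that one_minus_exp_minus_bounds[of x] by (auto simp: k_def abs_mult divide_right_mono)
  qed (auto simp: k_def)
  then have lim: "((\<lambda>l. (LINT t:{0<..}|lborel. (1 - exp (- (l * t))) * q t) / (l * (- ln l))) \<longlongrightarrow> C) (at_right 0)"
  proof (rule Lim_transform_eventually)
    show "\<forall>\<^sub>F l in at_right 0. (LINT t:{0<..}|lborel. k (l * t) * (t powr s * q t) / t) / (- ln l)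
       = (LINT t:{0<..}|lborel. (1 - exp (- (l * t))) * q t) / (l * (- ln l))"
      using eventually_at_right_less[of 0]
    proof eventually_elim
      case (elim l)
      have "(LINT t:{0<..}|lborel. k (l * t) * (t powr s * q t) / t) = (LINT t:{0<..}|lborel. (1 - exp (- (l * t))) * q t / l)"
        using elim by (intro set_lebesgue_integral_cong)
          (auto simp: assms k_def powr_numeral power2_eq_square)
      then show ?case using elim by simp
    qed
  qed
  show "(\<lambda>l. laplace l - laplace 0) \<sim>[at_right 0] (\<lambda>l. C * l * ln l)"
    using laplace_diff_asympI[OF _ C_pos _ lim] assms by (simp add: mult.assoc mult_pos_neg)
qed

text \<open>The first moment of q is finite, and (1 - exp (- l t)) / l is at most t and tends to t.
  The constant is that moment, so it depends on all of q and not only on its tail.\<close>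

lemma laplace_asymp_s_greater_2:
  assumes "s > 2"
  shows "\<exists>\<gamma>>0. (\<lambda>l. laplace l - laplace 0) \<sim>[at_right 0] (\<lambda>l. - \<gamma> * l)"
proof (intro exI conjI)
  have i: "set_integrable lborel {0<..} (\<lambda>t. t * q t)"
    by (rule set_integrable_mult_q[where p=1 and A=1 and r=1 and B=1]) (use assms in auto)
  show pos: "(LINT t:{0<..}|lborel. t * q t) > 0"
    using q_pos by (intro set_integral_pos i) simp
  define F where "F y t = indicator {0<..} t *\<^sub>R ((1 - exp (- (inverse y * t))) * y * q t)" for y t :: real
  have "((\<lambda>y. \<integral>t. F y t \<partial>lborel) \<longlongrightarrow> (\<integral>t. indicator {0<..} t *\<^sub>R (t * q t) \<partial>lborel)) at_top"
  proof (rule integral_dominated_convergence_at_top)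
    show "integrable lborel (\<lambda>t. indicator {0<..} t *\<^sub>R (t * q t))"
      using i by (simp add: set_integrable_def)
    show "AE t in lborel. ((\<lambda>y. F y t) \<longlongrightarrow> indicator {0<..} t *\<^sub>R (t * q t)) at_top"
    proof (rule AE_I2)
      fix t :: real
      have "((\<lambda>y. (1 - exp (- (inverse y * t))) * y) \<longlongrightarrow> t) at_top"
        by (cases "t = 0"; real_asymp)
      then show "((\<lambda>y. F y t) \<longlongrightarrow> indicator {0<..} t *\<^sub>R (t * q t)) at_top"
        unfolding F_def by (intro tendsto_intros)
    qed
    show "\<forall>\<^sub>F y in at_top. AE t in lborel. norm (F y t) \<le> indicator {0<..} t *\<^sub>R (t * q t)"
      using eventually_gt_at_top[of 0]
    proof eventually_elim
      case (elim y)
      have "norm (F y t) \<le> indicator {0<..} t *\<^sub>R (t * q t)" for t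
      proof (cases "t > 0")
        case True
        have "(1 - exp (- (inverse y * t))) * y \<le> (inverse y * t) * y"
          using True elim by (intro mult_right_mono one_minus_exp_minus_bounds) auto
        also have "\<dots> = t" using elim by simp
        finally have "(1 - exp (- (inverse y * t))) * y * q t \<le> t * q t"
          using True elim q_pos[of t] by (intro mult_right_mono) auto
        moreover have "0 \<le> (1 - exp (- (inverse y * t))) * y * q t"
          using True elim q_pos[of t] by (intro mult_nonneg_nonneg one_minus_exp_minus_bounds) auto
        ultimately show ?thesis using True by (simp add: F_def)
      qed (simp add: F_def)
      then show ?case by simp
    qed
    show "F y \<in> borel_measurable lborel" for y unfolding F_def by measurable
  qed measurable
  from filterlim_compose[OF this filterlim_inverse_at_top_right]
  have "((\<lambda>l. (LINT t:{0<..}|lborel. (1 - exp (- (l * t))) * q t) / l) \<longlongrightarrow> (LINT t:{0<..}|lborel. t * q t)) (at_right 0)"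
    unfolding F_def set_lebesgue_integral_def
    by (simp add: divide_inverse mult.assoc flip: integral_mult_left_zero)
       (simp add: mult_ac)
  from laplace_diff_asympI[OF _ pos _ this] assms
  show "(\<lambda>l. laplace l - laplace 0) \<sim>[at_right 0] (\<lambda>l. - (LINT t:{0<..}|lborel. t * q t) * l)"
    by simp
qed

end

text \<open>The case distinction compares s = d / \<alpha> with 1 and 2; for d >= 4 the bound
  \<alpha> < 2 alone gives s > 2. Integrability of the return probability is asserted in the last
  three cases because a Bochner integral that does not exist is 0 by convention: it certifies that
  \<open>green0 a 0\<close> is the finite Green function.\<close>

theorem theorem3:
  fixes a :: "int ^ 'n \<Rightarrow> real" and H :: "real ^ 'n \<Rightarrow> real" and \<alpha> :: real
  assumes "rw_intensities a"
    and "0 < \<alpha>" "\<alpha> < 2"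
    and "continuous_on (sphere 0 1) H"
    and "\<forall>x\<in>sphere 0 1. H x > 0"
    and "\<forall>x\<in>sphere 0 1. H (- x) = H x"
    and "a \<sim>[cofinite] (\<lambda>z. H ((1 / norm (vec_of z)) *\<^sub>R vec_of z) /
                                norm (vec_of z) powr (real CARD('n) + \<alpha>))"
  shows
   "(CARD('n) = 1 \<and> 1 < \<alpha> \<longrightarrow>
       (\<exists>\<gamma>>0. green0 a \<sim>[at_right 0] (\<lambda>l. \<gamma> * l powr ((1 - \<alpha>) / \<alpha>)))) \<and>
    (CARD('n) = 1 \<and> \<alpha> = 1 \<longrightarrow>
       (\<exists>\<gamma>>0. green0 a \<sim>[at_right 0] (\<lambda>l. - \<gamma> * ln l))) \<and>
    ((CARD('n) = 1 \<and> 1/2 < \<alpha> \<and> \<alpha> < 1 \<or> CARD('n) = 2 \<and> 1 < \<alpha> \<or>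
      CARD('n) = 3 \<and> 3/2 < \<alpha>) \<longrightarrow>
       set_integrable lborel {0..} (\<lambda>t. trans_prob a t 0 0) \<and>
       (\<exists>\<gamma>>0. (\<lambda>l. green0 a l - green0 a 0) \<sim>[at_right 0]
                 (\<lambda>l. - \<gamma> * l powr ((real CARD('n) - \<alpha>) / \<alpha>)))) \<and>
    ((CARD('n) = 1 \<and> \<alpha> = 1/2 \<or> CARD('n) = 2 \<and> \<alpha> = 1 \<or> CARD('n) = 3 \<and> \<alpha> = 3/2) \<longrightarrow>
       set_integrable lborel {0..} (\<lambda>t. trans_prob a t 0 0) \<and>
       (\<exists>\<gamma>>0. (\<lambda>l. green0 a l - green0 a 0) \<sim>[at_right 0] (\<lambda>l. \<gamma> * l * ln l))) \<and>
    ((CARD('n) = 1 \<and> \<alpha> < 1/2 \<or> CARD('n) = 2 \<and> \<alpha> < 1 \<or> CARD('n) = 3 \<and> \<alpha> < 3/2 \<or>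
      CARD('n) \<ge> 4) \<longrightarrow>
       set_integrable lborel {0..} (\<lambda>t. trans_prob a t 0 0) \<and>
       (\<exists>\<gamma>>0. (\<lambda>l. green0 a l - green0 a 0) \<sim>[at_right 0] (\<lambda>l. - \<gamma> * l)))"
proof -
  define s where "s = real CARD('n) / \<alpha>"
  interpret stable_rw a H \<alpha>
    using assms by unfold_locales auto
  obtain C where C: "C > 0" "((\<lambda>t. t powr (CARD('n) / \<alpha>) * trans_prob a t 0 0) \<longlongrightarrow> C) at_top"
    by (rule trans_prob_asymp)
  interpret power_tail "\<lambda>t. trans_prob a t 0 0" s C
    using trans_prob_measurable trans_prob_bounds C alpha by unfold_locales (auto simp: s_def)
  have green: "green0 a = laplace"
    by (simp add: fun_eq_iff green0_def laplace_def)
  have e: "(real CARD('n) - \<alpha>) / \<alpha> = s - 1"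
    using alpha by (simp add: s_def diff_divide_distrib)
  show ?thesis
  proof (intro conjI impI)
    assume "CARD('n) = 1 \<and> 1 < \<alpha>"
    then have "s < 1" "(1 - \<alpha>) / \<alpha> = s - 1" using e by (simp_all add: s_def)
    then show "\<exists>\<gamma>>0. green0 a \<sim>[at_right 0] (\<lambda>l. \<gamma> * l powr ((1 - \<alpha>) / \<alpha>))"
      using laplace_asymp_s_less_1 by (simp add: green)
  next
    assume "CARD('n) = 1 \<and> \<alpha> = 1"
    then show "\<exists>\<gamma>>0. green0 a \<sim>[at_right 0] (\<lambda>l. - \<gamma> * ln l)"
      using laplace_asymp_s_eq_1 unfolding green by (simp add: s_def)
  next
    assume "CARD('n) = 1 \<and> 1/2 < \<alpha> \<and> \<alpha> < 1 \<or> CARD('n) = 2 \<and> 1 < \<alpha> \<or> CARD('n) = 3 \<and> 3/2 < \<alpha>"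
    then have s: "1 < s" "s < 2" using alpha by (auto simp: s_def field_simps)
    show "set_integrable lborel {0..} (\<lambda>t. trans_prob a t 0 0)"
      by (rule set_integrable_q_Ici[OF s(1)])
    show "\<exists>\<gamma>>0. (\<lambda>l. green0 a l - green0 a 0) \<sim>[at_right 0] (\<lambda>l. - \<gamma> * l powr ((real CARD('n) - \<alpha>) / \<alpha>))"
      unfolding green e by (rule laplace_asymp_s_between_1_2[OF s])
  next
    assume "CARD('n) = 1 \<and> \<alpha> = 1/2 \<or> CARD('n) = 2 \<and> \<alpha> = 1 \<or> CARD('n) = 3 \<and> \<alpha> = 3/2"
    then have "2 * \<alpha> = real CARD('n)" by auto
    then have s: "s = 2" using alpha by (simp add: s_def field_simps)
    show "set_integrable lborel {0..} (\<lambda>t. trans_prob a t 0 0)"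
      by (rule set_integrable_q_Ici) (simp add: s)
    show "\<exists>\<gamma>>0. (\<lambda>l. green0 a l - green0 a 0) \<sim>[at_right 0] (\<lambda>l. \<gamma> * l * ln l)"
      unfolding green by (rule laplace_asymp_s_eq_2[OF s])
  next
    assume "CARD('n) = 1 \<and> \<alpha> < 1/2 \<or> CARD('n) = 2 \<and> \<alpha> < 1 \<or> CARD('n) = 3 \<and> \<alpha> < 3/2 \<or> CARD('n) \<ge> 4"
    then have "2 * \<alpha> < real CARD('n)" using alpha by auto
    then have s: "s > 2" using alpha by (simp add: s_def field_simps)
    show "set_integrable lborel {0..} (\<lambda>t. trans_prob a t 0 0)"
      by (rule set_integrable_q_Ici) (use s in simp)
    show "\<exists>\<gamma>>0. (\<lambda>l. green0 a l - green0 a 0) \<sim>[at_right 0] (\<lambda>l. - \<gamma> * l)"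
      unfolding green by (rule laplace_asymp_s_greater_2[OF s])
  qed
qed

end
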